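(* Let $R$ be an associative ring with unit, let $M,N$ be automorphism-invariant right $R$-modules, and let $f:M\rightarrow N$ and $g:N\rightarrow M$ be monomorphisms. Then $M\cong N$.
   Context: Modules are unitary right modules over an associative ring $R$ with unit. A module $M$ with injective envelope $u:M\rightarrow E(M)$ is automorphism-invariant if for every automorphism $\varphi$ of $E(M)$ there exists an endomorphism $f:M\rightarrow M$ such that $u\circ f=\varphi\circ u$ (i.e. $M$ is invariant under all automorphisms of its injective envelope). *)

theory Defs
  imports "HOL-Algebra.Module"
begin

text \<open>Unitary right modules over a not necessarily commutative ring. The library locale
  \<open>module\<close> requires a commutative ring of scalars acting from the left. As in the
  library record \<open>module\<close>, only \<open>carrier\<close>, \<open>zero\<close> and \<open>add\<close> of the underlying ring record
  are meaningful; \<open>mult\<close> and \<open>one\<close> are ignored throughout.\<close>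

record ('r, 'm) right_module = "'m ring" +
  rsmult :: "['m, 'r] \<Rightarrow> 'm" (infixl \<open>\<cdot>\<index>\<close> 70)

locale right_module = R?: ring R + M?: abelian_group M
  for R :: "('r, 'x) ring_scheme" and M :: "('r, 'm) right_module" (structure) +
  assumes rsmult_closed [simp, intro]:
      "\<lbrakk>x \<in> carrier M; r \<in> carrier R\<rbrakk> \<Longrightarrow> x \<cdot>\<^bsub>M\<^esub> r \<in> carrier M"
    and rsmult_l_distr:
      "\<lbrakk>x \<in> carrier M; y \<in> carrier M; r \<in> carrier R\<rbrakk> \<Longrightarrow>
        (x \<oplus>\<^bsub>M\<^esub> y) \<cdot>\<^bsub>M\<^esub> r = x \<cdot>\<^bsub>M\<^esub> r \<oplus>\<^bsub>M\<^esub> y \<cdot>\<^bsub>M\<^esub> r"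
    and rsmult_r_distr:
      "\<lbrakk>x \<in> carrier M; r \<in> carrier R; s \<in> carrier R\<rbrakk> \<Longrightarrow>
        x \<cdot>\<^bsub>M\<^esub> (r \<oplus>\<^bsub>R\<^esub> s) = x \<cdot>\<^bsub>M\<^esub> r \<oplus>\<^bsub>M\<^esub> x \<cdot>\<^bsub>M\<^esub> s"
    and rsmult_assoc:
      "\<lbrakk>x \<in> carrier M; r \<in> carrier R; s \<in> carrier R\<rbrakk> \<Longrightarrow>
        x \<cdot>\<^bsub>M\<^esub> (r \<otimes>\<^bsub>R\<^esub> s) = (x \<cdot>\<^bsub>M\<^esub> r) \<cdot>\<^bsub>M\<^esub> s"
    and rsmult_one [simp]:
      "x \<in> carrier M \<Longrightarrow> x \<cdot>\<^bsub>M\<^esub> \<one>\<^bsub>R\<^esub> = x"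

definition right_submodule ::
    "'m set \<Rightarrow> ('r, 'x) ring_scheme \<Rightarrow> ('r, 'm) right_module \<Rightarrow> bool" where
  "right_submodule K R M \<longleftrightarrow>
     subgroup K (add_monoid M) \<and> (\<forall>x\<in>K. \<forall>r\<in>carrier R. x \<cdot>\<^bsub>M\<^esub> r \<in> K)"

definition rmod_hom ::
    "('r, 'x) ring_scheme \<Rightarrow> ('r, 'a) right_module \<Rightarrow> ('r, 'b) right_module \<Rightarrow> ('a \<Rightarrow> 'b) set" where
  "rmod_hom R A B =
     {h \<in> hom (add_monoid A) (add_monoid B).
        \<forall>x\<in>carrier A. \<forall>r\<in>carrier R. h (x \<cdot>\<^bsub>A\<^esub> r) = h x \<cdot>\<^bsub>B\<^esub> r}"

definition rmod_mon ::
    "('r, 'x) ring_scheme \<Rightarrow> ('r, 'a) right_module \<Rightarrow> ('r, 'b) right_module \<Rightarrow> ('a \<Rightarrow> 'b) set" where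
  "rmod_mon R A B = {h \<in> rmod_hom R A B. inj_on h (carrier A)}"

definition rmod_iso ::
    "('r, 'x) ring_scheme \<Rightarrow> ('r, 'a) right_module \<Rightarrow> ('r, 'b) right_module \<Rightarrow> ('a \<Rightarrow> 'b) set" where
  "rmod_iso R A B = {h \<in> rmod_hom R A B. bij_betw h (carrier A) (carrier B)}"

definition rmod_isomorphic ::
    "('r, 'x) ring_scheme \<Rightarrow> ('r, 'a) right_module \<Rightarrow> ('r, 'b) right_module \<Rightarrow> bool" where
  "rmod_isomorphic R A B \<longleftrightarrow> rmod_iso R A B \<noteq> {}"

text \<open>A definition cannot quantify over types, so the test modules \<open>A\<close>, \<open>B\<close> below are those
  whose elements lie in the type of ring elements. This is no restriction: the lemma
  \<open>injective_rmod_extend\<close> at the end of this theory (Baer's argument) shows that an injective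
  module in this sense has the extension property for test modules of arbitrary types.\<close>

definition injective_rmod ::
    "('r, 'x) ring_scheme \<Rightarrow> ('r, 'e) right_module \<Rightarrow> bool" where
  "injective_rmod R E \<longleftrightarrow>
     right_module R E \<and>
     (\<forall>(A :: ('r, 'r) right_module) (B :: ('r, 'r) right_module) i h.
        right_module R A \<and> right_module R B \<and> i \<in> rmod_mon R A B \<and> h \<in> rmod_hom R A E \<longrightarrow>
        (\<exists>k \<in> rmod_hom R B E. \<forall>a\<in>carrier A. k (i a) = h a))"

definition essential_in ::
    "'m set \<Rightarrow> ('r, 'x) ring_scheme \<Rightarrow> ('r, 'm) right_module \<Rightarrow> bool" where
  "essential_in L R M \<longleftrightarrow>
     right_submodule L R M \<and>
     (\<forall>K. right_submodule K R M \<and> L \<inter> K = {\<zero>\<^bsub>M\<^esub>} \<longrightarrow> K = {\<zero>\<^bsub>M\<^esub>})"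

definition injective_envelope ::
    "('r, 'x) ring_scheme \<Rightarrow> ('r, 'm) right_module \<Rightarrow> ('r, 'e) right_module \<Rightarrow> ('m \<Rightarrow> 'e) \<Rightarrow> bool"
  where
  "injective_envelope R M E u \<longleftrightarrow>
     right_module R M \<and> injective_rmod R E \<and> u \<in> rmod_mon R M E \<and>
     essential_in (u ` carrier M) R E"

text \<open>The envelope \<open>u : M \<rightarrow> E\<close> is an explicit argument because \<open>E\<close> need not fit into the
  type of \<open>M\<close>. The condition does not depend on its choice, as injective envelopes are
  unique up to an isomorphism under \<open>M\<close>.\<close>

definition automorphism_invariant ::
    "('r, 'x) ring_scheme \<Rightarrow> ('r, 'm) right_module \<Rightarrow> ('r, 'e) right_module \<Rightarrow> ('m \<Rightarrow> 'e) \<Rightarrow> bool"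
  where
  "automorphism_invariant R M E u \<longleftrightarrow>
     injective_envelope R M E u \<and>
     (\<forall>\<phi> \<in> rmod_iso R E E. \<exists>f \<in> rmod_hom R M M. \<forall>x\<in>carrier M. u (f x) = \<phi> (u x))"


lemma rmod_homI:
  assumes "\<And>x. x \<in> carrier A \<Longrightarrow> h x \<in> carrier B"
    and "\<And>x y. \<lbrakk>x \<in> carrier A; y \<in> carrier A\<rbrakk> \<Longrightarrow> h (x \<oplus>\<^bsub>A\<^esub> y) = h x \<oplus>\<^bsub>B\<^esub> h y"
    and "\<And>x r. \<lbrakk>x \<in> carrier A; r \<in> carrier R\<rbrakk> \<Longrightarrow> h (x \<cdot>\<^bsub>A\<^esub> r) = h x \<cdot>\<^bsub>B\<^esub> r"
  shows "h \<in> rmod_hom R A B"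
  using assms by (auto simp: rmod_hom_def hom_def)

lemma rmod_homD:
  assumes "h \<in> rmod_hom R A B"
  shows "x \<in> carrier A \<Longrightarrow> h x \<in> carrier B"
    and "\<lbrakk>x \<in> carrier A; y \<in> carrier A\<rbrakk> \<Longrightarrow> h (x \<oplus>\<^bsub>A\<^esub> y) = h x \<oplus>\<^bsub>B\<^esub> h y"
    and "\<lbrakk>x \<in> carrier A; r \<in> carrier R\<rbrakk> \<Longrightarrow> h (x \<cdot>\<^bsub>A\<^esub> r) = h x \<cdot>\<^bsub>B\<^esub> r"
  using assms by (auto simp: rmod_hom_def hom_def)

lemma (in right_module) rsmult_zero:
  assumes "x \<in> carrier M"
  shows "x \<cdot>\<^bsub>M\<^esub> \<zero>\<^bsub>R\<^esub> = \<zero>\<^bsub>M\<^esub>"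
proof -
  have "x \<cdot>\<^bsub>M\<^esub> \<zero>\<^bsub>R\<^esub> \<oplus>\<^bsub>M\<^esub> x \<cdot>\<^bsub>M\<^esub> \<zero>\<^bsub>R\<^esub> = x \<cdot>\<^bsub>M\<^esub> \<zero>\<^bsub>R\<^esub>"
    using assms rsmult_r_distr[of x "\<zero>\<^bsub>R\<^esub>" "\<zero>\<^bsub>R\<^esub>"] by simp
  then show ?thesis
    using assms M.add.r_cancel_one' R.zero_closed rsmult_closed by metis
qed

lemma (in right_module) rsmult_minus:
  assumes "x \<in> carrier M" "r \<in> carrier R"
  shows "x \<cdot>\<^bsub>M\<^esub> (\<ominus>\<^bsub>R\<^esub> r) = \<ominus>\<^bsub>M\<^esub> (x \<cdot>\<^bsub>M\<^esub> r)"
proof -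
  have "x \<cdot>\<^bsub>M\<^esub> (\<ominus>\<^bsub>R\<^esub> r) \<oplus>\<^bsub>M\<^esub> x \<cdot>\<^bsub>M\<^esub> r = \<zero>\<^bsub>M\<^esub>"
    using assms rsmult_r_distr[of x "\<ominus>\<^bsub>R\<^esub> r" r] by (simp add: R.l_neg rsmult_zero)
  then show ?thesis
    using assms by (simp add: M.minus_equality)
qed

lemma (in right_module) minus_eq_rsmult:
  assumes "x \<in> carrier M"
  shows "\<ominus>\<^bsub>M\<^esub> x = x \<cdot>\<^bsub>M\<^esub> (\<ominus>\<^bsub>R\<^esub> \<one>\<^bsub>R\<^esub>)"
  using assms by (simp add: rsmult_minus)

text \<open>Submodules of \<open>B \<times> E\<close>, used as graphs of partial homomorphisms.\<close>

definition rmod_linrel ::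
    "('r, 'x) ring_scheme \<Rightarrow> ('r, 'b) right_module \<Rightarrow> ('r, 'e) right_module \<Rightarrow> ('b \<times> 'e) set \<Rightarrow> bool"
  where
  "rmod_linrel R B E G \<longleftrightarrow>
     G \<subseteq> carrier B \<times> carrier E \<and> (\<zero>\<^bsub>B\<^esub>, \<zero>\<^bsub>E\<^esub>) \<in> G \<and>
     (\<forall>b y c z. (b, y) \<in> G \<and> (c, z) \<in> G \<longrightarrow> (b \<oplus>\<^bsub>B\<^esub> c, y \<oplus>\<^bsub>E\<^esub> z) \<in> G) \<and>
     (\<forall>b y. \<forall>r\<in>carrier R. (b, y) \<in> G \<longrightarrow> (b \<cdot>\<^bsub>B\<^esub> r, y \<cdot>\<^bsub>E\<^esub> r) \<in> G) \<and>
     (\<forall>y. (\<zero>\<^bsub>B\<^esub>, y) \<in> G \<longrightarrow> y = \<zero>\<^bsub>E\<^esub>)"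

lemma rmod_linrel_diff:
  assumes "right_module R B" "right_module R E" "rmod_linrel R B E G"
    and "(b, y) \<in> G" "(c, z) \<in> G"
  shows "(b \<ominus>\<^bsub>B\<^esub> c, y \<ominus>\<^bsub>E\<^esub> z) \<in> G"
proof -
  interpret B: right_module R B by fact
  interpret E: right_module R E by fact
  have mem: "c \<in> carrier B" "z \<in> carrier E"
    using assms(3,5) by (auto simp: rmod_linrel_def)
  have "(c \<cdot>\<^bsub>B\<^esub> (\<ominus>\<^bsub>R\<^esub> \<one>\<^bsub>R\<^esub>), z \<cdot>\<^bsub>E\<^esub> (\<ominus>\<^bsub>R\<^esub> \<one>\<^bsub>R\<^esub>)) \<in> G"
    using assms(3,5) by (auto simp: rmod_linrel_def)
  then have "(\<ominus>\<^bsub>B\<^esub> c, \<ominus>\<^bsub>E\<^esub> z) \<in> G"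
    using mem by (simp add: B.minus_eq_rsmult E.minus_eq_rsmult)
  then show ?thesis
    using assms(3,4) unfolding a_minus_def rmod_linrel_def by blast
qed

lemma rmod_linrel_unique:
  assumes "right_module R B" "right_module R E" "rmod_linrel R B E G"
    and "(b, y) \<in> G" "(b, z) \<in> G"
  shows "y = z"
proof -
  interpret B: right_module R B by fact
  interpret E: right_module R E by fact
  have mem: "b \<in> carrier B" "y \<in> carrier E" "z \<in> carrier E"
    using assms(3,4,5) by (auto simp: rmod_linrel_def)
  have "(b \<ominus>\<^bsub>B\<^esub> b, y \<ominus>\<^bsub>E\<^esub> z) \<in> G"
    by (rule rmod_linrel_diff) (use assms in auto)
  then have "y \<ominus>\<^bsub>E\<^esub> z = \<zero>\<^bsub>E\<^esub>"
    using assms(3) mem by (simp add: rmod_linrel_def B.M.r_neg a_minus_def)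
  then show ?thesis
    using mem E.M.minus_equality[of y "\<ominus>\<^bsub>E\<^esub> z"] by (simp add: a_minus_def)
qed

lemma rmod_linrel_extend:
  assumes inj: "injective_rmod R E" and B: "right_module R B"
    and G: "rmod_linrel R B E G" and b: "b \<in> carrier B"
  shows "\<exists>G'. rmod_linrel R B E G' \<and> G \<subseteq> G' \<and> b \<in> fst ` G'"
proof -
  have E: "right_module R E"
    using inj by (simp add: injective_rmod_def)
  interpret B: right_module R B by fact
  interpret E: right_module R E by fact
  note uniq = rmod_linrel_unique[OF B E G]
  have Gsub: "\<And>c y. (c, y) \<in> G \<Longrightarrow> c \<in> carrier B \<and> y \<in> carrier E"
    and G0: "(\<zero>\<^bsub>B\<^esub>, \<zero>\<^bsub>E\<^esub>) \<in> G"
    and Gadd: "\<And>c y d z. (c, y) \<in> G \<Longrightarrow> (d, z) \<in> G \<Longrightarrow> (c \<oplus>\<^bsub>B\<^esub> d, y \<oplus>\<^bsub>E\<^esub> z) \<in> G"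
    and Gsm: "\<And>c y r. (c, y) \<in> G \<Longrightarrow> r \<in> carrier R \<Longrightarrow> (c \<cdot>\<^bsub>B\<^esub> r, y \<cdot>\<^bsub>E\<^esub> r) \<in> G"
    using G by (auto simp: rmod_linrel_def)
  define I where "I = {r \<in> carrier R. b \<cdot>\<^bsub>B\<^esub> r \<in> fst ` G}"
  define RR :: "('a, 'a) right_module" where
    "RR = \<lparr>carrier = carrier R, mult = undefined, one = undefined, zero = \<zero>\<^bsub>R\<^esub>,
       add = add R, rsmult = mult R\<rparr>"
  define A :: "('a, 'a) right_module" where
    "A = \<lparr>carrier = I, mult = undefined, one = undefined, zero = \<zero>\<^bsub>R\<^esub>,
       add = add R, rsmult = mult R\<rparr>"
  have IR: "r \<in> carrier R" if "r \<in> I" for r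
    using that by (simp add: I_def)
  have I0: "\<zero>\<^bsub>R\<^esub> \<in> I"
    using G0 b by (force simp: I_def B.rsmult_zero)
  have Iadd: "r \<oplus>\<^bsub>R\<^esub> s \<in> I" if "r \<in> I" "s \<in> I" for r s
    using that b Gadd by (force simp: I_def B.rsmult_r_distr)
  have Ism: "r \<otimes>\<^bsub>R\<^esub> s \<in> I" if "r \<in> I" "s \<in> carrier R" for r s
    using that b Gsm by (force simp: I_def B.rsmult_assoc)
  have Ineg: "\<ominus>\<^bsub>R\<^esub> r \<in> I" if "r \<in> I" for r
  proof -
    have "r \<otimes>\<^bsub>R\<^esub> (\<ominus>\<^bsub>R\<^esub> \<one>\<^bsub>R\<^esub>) \<in> I"
      using that by (intro Ism) auto
    then show ?thesis
      using IR[OF that] by (simp add: B.R.r_minus)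
  qed
  have RR: "right_module R RR"
  proof (intro right_module.intro right_module_axioms.intro abelian_groupI)
    show "ring R" by (rule B.R.ring_axioms)
    show "\<exists>y\<in>carrier RR. y \<oplus>\<^bsub>RR\<^esub> x = \<zero>\<^bsub>RR\<^esub>" if "x \<in> carrier RR" for x
      using that by (auto simp: RR_def intro!: bexI[of _ "\<ominus>\<^bsub>R\<^esub> x"] B.R.l_neg)
  qed (auto simp: RR_def B.R.a_ac B.R.l_distr B.R.r_distr B.R.m_assoc)
  have A: "right_module R A"
  proof (intro right_module.intro right_module_axioms.intro abelian_groupI)
    show "ring R" by (rule B.R.ring_axioms)
    show "\<exists>y\<in>carrier A. y \<oplus>\<^bsub>A\<^esub> x = \<zero>\<^bsub>A\<^esub>" if "x \<in> carrier A" for x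
      using that by (auto simp: A_def IR intro!: bexI[of _ "\<ominus>\<^bsub>R\<^esub> x"] B.R.l_neg Ineg)
  qed (auto simp: A_def IR I0 Iadd Ism B.R.a_ac B.R.l_distr B.R.r_distr B.R.m_assoc)
  define h where "h r = (THE y. (b \<cdot>\<^bsub>B\<^esub> r, y) \<in> G)" for r
  have h_eq: "h r = y" if "(b \<cdot>\<^bsub>B\<^esub> r, y) \<in> G" for r y
    unfolding h_def using that uniq by blast
  have h_mem: "(b \<cdot>\<^bsub>B\<^esub> r, h r) \<in> G" if "r \<in> I" for r
    using that h_eq by (force simp: I_def)
  have hA: "h \<in> rmod_hom R A E"
  proof (rule rmod_homI)
    fix r s assume "r \<in> carrier A" "s \<in> carrier A"
    then have rs: "r \<in> I" "s \<in> I" by (auto simp: A_def)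
    have "h (r \<oplus>\<^bsub>R\<^esub> s) = h r \<oplus>\<^bsub>E\<^esub> h s"
      using Gadd[OF h_mem[OF rs(1)] h_mem[OF rs(2)]] rs b
      by (intro h_eq) (simp add: IR B.rsmult_r_distr)
    then show "h (r \<oplus>\<^bsub>A\<^esub> s) = h r \<oplus>\<^bsub>E\<^esub> h s" by (simp add: A_def)
  next
    fix r s assume "r \<in> carrier A" and s: "s \<in> carrier R"
    then have r: "r \<in> I" by (auto simp: A_def)
    have "h (r \<otimes>\<^bsub>R\<^esub> s) = h r \<cdot>\<^bsub>E\<^esub> s"
      using Gsm[OF h_mem[OF r] s] r s b
      by (intro h_eq) (simp add: IR B.rsmult_assoc)
    then show "h (r \<cdot>\<^bsub>A\<^esub> s) = h r \<cdot>\<^bsub>E\<^esub> s" by (simp add: A_def)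
  qed (use h_mem Gsub in \<open>auto simp: A_def\<close>)
  have "id \<in> rmod_mon R A RR"
    unfolding rmod_mon_def by (auto simp: A_def RR_def IR intro!: rmod_homI)
  then obtain k where k: "k \<in> rmod_hom R RR E" and kh: "\<And>r. r \<in> I \<Longrightarrow> k r = h r"
    using inj A RR hA unfolding injective_rmod_def by (force simp: A_def)
  define e where "e = k \<one>\<^bsub>R\<^esub>"
  have e: "e \<in> carrier E"
    using rmod_homD(1)[OF k, of "\<one>\<^bsub>R\<^esub>"] by (simp add: e_def RR_def)
  have ke: "k r = e \<cdot>\<^bsub>E\<^esub> r" if "r \<in> carrier R" for r
    using rmod_homD(3)[OF k, of "\<one>\<^bsub>R\<^esub>" r] that by (simp add: e_def RR_def)
  have key: "y = e \<cdot>\<^bsub>E\<^esub> r" if "r \<in> carrier R" "(b \<cdot>\<^bsub>B\<^esub> r, y) \<in> G" for r y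
  proof -
    have "r \<in> I" using that by (force simp: I_def)
    then show ?thesis using kh ke h_eq that by metis
  qed
  define G' where
    "G' = {(c \<oplus>\<^bsub>B\<^esub> b \<cdot>\<^bsub>B\<^esub> r, y \<oplus>\<^bsub>E\<^esub> e \<cdot>\<^bsub>E\<^esub> r) | c y r. (c, y) \<in> G \<and> r \<in> carrier R}"
  have G'I: "(c', y') \<in> G'"
    if "(c, y) \<in> G" "r \<in> carrier R" "c' = c \<oplus>\<^bsub>B\<^esub> b \<cdot>\<^bsub>B\<^esub> r" "y' = y \<oplus>\<^bsub>E\<^esub> e \<cdot>\<^bsub>E\<^esub> r" for c y r c' y'
    using that by (auto simp: G'_def)
  have G'E: "\<exists>c y r. (c, y) \<in> G \<and> r \<in> carrier R \<and> c' = c \<oplus>\<^bsub>B\<^esub> b \<cdot>\<^bsub>B\<^esub> r \<and> y' = y \<oplus>\<^bsub>E\<^esub> e \<cdot>\<^bsub>E\<^esub> r"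
    if "(c', y') \<in> G'" for c' y'
    using that by (auto simp: G'_def)
  have sub: "G \<subseteq> G'"
  proof (clarify)
    fix c y assume "(c, y) \<in> G"
    then show "(c, y) \<in> G'"
      using Gsub[of c y] b e
      by (intro G'I[of c y "\<zero>\<^bsub>R\<^esub>"]) (auto simp: B.rsmult_zero E.rsmult_zero)
  qed
  have "(b, e) \<in> G'"
    using b e by (intro G'I[OF G0, of "\<one>\<^bsub>R\<^esub>"]) auto
  then have dom: "b \<in> fst ` G'" by force
  have "rmod_linrel R B E G'"
    unfolding rmod_linrel_def
  proof (intro conjI allI ballI impI)
    show "G' \<subseteq> carrier B \<times> carrier E"
      using b e Gsub by (fastforce simp: G'_def)
    show "(\<zero>\<^bsub>B\<^esub>, \<zero>\<^bsub>E\<^esub>) \<in> G'" using G0 sub by blast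
  next
    fix c' y' d' z' assume "(c', y') \<in> G' \<and> (d', z') \<in> G'"
    then obtain c y r d z s where *: "(c, y) \<in> G" "r \<in> carrier R" "(d, z) \<in> G" "s \<in> carrier R"
      "c' = c \<oplus>\<^bsub>B\<^esub> b \<cdot>\<^bsub>B\<^esub> r" "y' = y \<oplus>\<^bsub>E\<^esub> e \<cdot>\<^bsub>E\<^esub> r" "d' = d \<oplus>\<^bsub>B\<^esub> b \<cdot>\<^bsub>B\<^esub> s" "z' = z \<oplus>\<^bsub>E\<^esub> e \<cdot>\<^bsub>E\<^esub> s"
      using G'E by metis
    show "(c' \<oplus>\<^bsub>B\<^esub> d', y' \<oplus>\<^bsub>E\<^esub> z') \<in> G'"
      by (rule G'I[OF Gadd[OF *(1,3)], of "r \<oplus>\<^bsub>R\<^esub> s"])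
        (use * Gsub[OF *(1)] Gsub[OF *(3)] b e in
          \<open>simp_all add: B.rsmult_r_distr E.rsmult_r_distr B.M.a_ac E.M.a_ac\<close>)
  next
    fix c' y' s assume s: "s \<in> carrier R" and "(c', y') \<in> G'"
    then obtain c y r where *: "(c, y) \<in> G" "r \<in> carrier R"
      "c' = c \<oplus>\<^bsub>B\<^esub> b \<cdot>\<^bsub>B\<^esub> r" "y' = y \<oplus>\<^bsub>E\<^esub> e \<cdot>\<^bsub>E\<^esub> r"
      using G'E by metis
    show "(c' \<cdot>\<^bsub>B\<^esub> s, y' \<cdot>\<^bsub>E\<^esub> s) \<in> G'"
      by (rule G'I[OF Gsm[OF *(1) s], of "r \<otimes>\<^bsub>R\<^esub> s"])
        (use * Gsub[OF *(1)] s b e in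
          \<open>simp_all add: B.rsmult_l_distr E.rsmult_l_distr B.rsmult_assoc E.rsmult_assoc\<close>)
  next
    fix y' assume "(\<zero>\<^bsub>B\<^esub>, y') \<in> G'"
    then obtain c y r where *: "(c, y) \<in> G" "r \<in> carrier R"
      "\<zero>\<^bsub>B\<^esub> = c \<oplus>\<^bsub>B\<^esub> b \<cdot>\<^bsub>B\<^esub> r" "y' = y \<oplus>\<^bsub>E\<^esub> e \<cdot>\<^bsub>E\<^esub> r"
      using G'E by metis
    have cy: "c \<in> carrier B" "y \<in> carrier E" using Gsub *(1) by auto
    have "c = \<ominus>\<^bsub>B\<^esub> (b \<cdot>\<^bsub>B\<^esub> r)"
      using *(2,3) cy b by (metis B.M.minus_equality B.rsmult_closed)
    then have "c = b \<cdot>\<^bsub>B\<^esub> (\<ominus>\<^bsub>R\<^esub> r)"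
      using *(2) b by (simp add: B.rsmult_minus)
    then have "y = e \<cdot>\<^bsub>E\<^esub> (\<ominus>\<^bsub>R\<^esub> r)"
      using key[of "\<ominus>\<^bsub>R\<^esub> r" y] * by simp
    then show "y' = \<zero>\<^bsub>E\<^esub>"
      using * e by (simp add: E.rsmult_minus E.M.l_neg)
  qed
  with sub dom show ?thesis by blast
qed

lemma injective_rmod_extend:
  fixes A :: "('r, 'a) right_module" and B :: "('r, 'b) right_module"
  assumes inj: "injective_rmod R E" and A: "right_module R A" and B: "right_module R B"
    and i: "i \<in> rmod_mon R A B" and h: "h \<in> rmod_hom R A E"
  shows "\<exists>k \<in> rmod_hom R B E. \<forall>a\<in>carrier A. k (i a) = h a"
proof -
  have E: "right_module R E"
    using inj by (simp add: injective_rmod_def)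
  interpret A: right_module R A by fact
  interpret B: right_module R B by fact
  interpret E: right_module R E by fact
  have ih: "i \<in> rmod_hom R A B" and i_inj: "inj_on i (carrier A)"
    using i by (auto simp: rmod_mon_def)
  have i0: "i \<zero>\<^bsub>A\<^esub> = \<zero>\<^bsub>B\<^esub>"
    using rmod_homD(3)[OF ih, of "\<zero>\<^bsub>A\<^esub>" "\<zero>\<^bsub>R\<^esub>"] rmod_homD(1)[OF ih, of "\<zero>\<^bsub>A\<^esub>"]
    by (simp add: A.rsmult_zero B.rsmult_zero)
  have h0: "h \<zero>\<^bsub>A\<^esub> = \<zero>\<^bsub>E\<^esub>"
    using rmod_homD(3)[OF h, of "\<zero>\<^bsub>A\<^esub>" "\<zero>\<^bsub>R\<^esub>"] rmod_homD(1)[OF h, of "\<zero>\<^bsub>A\<^esub>"]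
    by (simp add: A.rsmult_zero E.rsmult_zero)
  define G0 where "G0 = (\<lambda>a. (i a, h a)) ` carrier A"
  define F where "F = {G. rmod_linrel R B E G \<and> G0 \<subseteq> G}"
  have "rmod_linrel R B E G0"
    unfolding rmod_linrel_def
  proof (intro conjI allI ballI impI)
    show "G0 \<subseteq> carrier B \<times> carrier E"
      using rmod_homD(1)[OF ih] rmod_homD(1)[OF h] by (auto simp: G0_def)
    show "(\<zero>\<^bsub>B\<^esub>, \<zero>\<^bsub>E\<^esub>) \<in> G0"
      unfolding G0_def by (rule image_eqI[of _ _ "\<zero>\<^bsub>A\<^esub>"]) (auto simp: i0 h0)
  next
    fix b y c z assume "(b, y) \<in> G0 \<and> (c, z) \<in> G0"
    then obtain a a' where "a \<in> carrier A" "a' \<in> carrier A" "b = i a" "y = h a" "c = i a'" "z = h a'"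
      by (auto simp: G0_def)
    then show "(b \<oplus>\<^bsub>B\<^esub> c, y \<oplus>\<^bsub>E\<^esub> z) \<in> G0"
      unfolding G0_def
      by (intro image_eqI[of _ _ "a \<oplus>\<^bsub>A\<^esub> a'"]) (auto simp: rmod_homD(2)[OF ih] rmod_homD(2)[OF h])
  next
    fix b y r assume "(b, y) \<in> G0" and "r \<in> carrier R"
    moreover from this obtain a where "a \<in> carrier A" "b = i a" "y = h a"
      by (auto simp: G0_def)
    ultimately show "(b \<cdot>\<^bsub>B\<^esub> r, y \<cdot>\<^bsub>E\<^esub> r) \<in> G0"
      unfolding G0_def
      by (intro image_eqI[of _ _ "a \<cdot>\<^bsub>A\<^esub> r"]) (auto simp: rmod_homD(3)[OF ih] rmod_homD(3)[OF h])
  next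
    fix y assume "(\<zero>\<^bsub>B\<^esub>, y) \<in> G0"
    then obtain a where "a \<in> carrier A" "i a = i \<zero>\<^bsub>A\<^esub>" "y = h a"
      by (auto simp: G0_def i0)
    then show "y = \<zero>\<^bsub>E\<^esub>"
      using i_inj h0 by (metis A.M.zero_closed inj_onD)
  qed
  then have "F \<noteq> {}" by (auto simp: F_def)
  moreover have "\<Union>C \<in> F" if ne: "C \<noteq> {}" and C: "subset.chain F C" for C
  proof -
    have lin: "rmod_linrel R B E G" "G0 \<subseteq> G" if "G \<in> C" for G
      using C that by (auto simp: subset.chain_def F_def)
    have two: "\<exists>G\<in>C. p \<in> G \<and> q \<in> G" if "p \<in> \<Union>C" "q \<in> \<Union>C" for p q
      using C that unfolding subset_chain_def by blast
    have "rmod_linrel R B E (\<Union>C)"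
      unfolding rmod_linrel_def
    proof (intro conjI allI ballI impI)
      show "\<Union>C \<subseteq> carrier B \<times> carrier E"
        using lin(1) unfolding rmod_linrel_def by blast
      show "(\<zero>\<^bsub>B\<^esub>, \<zero>\<^bsub>E\<^esub>) \<in> \<Union>C"
        using ne lin(1) unfolding rmod_linrel_def by blast
    next
      fix b y c z assume "(b, y) \<in> \<Union>C \<and> (c, z) \<in> \<Union>C"
      then obtain G where "G \<in> C" "(b, y) \<in> G" "(c, z) \<in> G" using two by blast
      then show "(b \<oplus>\<^bsub>B\<^esub> c, y \<oplus>\<^bsub>E\<^esub> z) \<in> \<Union>C"
        using lin(1) unfolding rmod_linrel_def by blast
    next
      fix b y r assume "r \<in> carrier R" "(b, y) \<in> \<Union>C"
      then show "(b \<cdot>\<^bsub>B\<^esub> r, y \<cdot>\<^bsub>E\<^esub> r) \<in> \<Union>C"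
        using lin(1) unfolding rmod_linrel_def by blast
    next
      fix y assume "(\<zero>\<^bsub>B\<^esub>, y) \<in> \<Union>C"
      then show "y = \<zero>\<^bsub>E\<^esub>"
        using lin(1) unfolding rmod_linrel_def by blast
    qed
    then show ?thesis using ne lin(2) by (auto simp: F_def)
  qed
  ultimately obtain G where GF: "G \<in> F" and max: "\<And>X. X \<in> F \<Longrightarrow> G \<subseteq> X \<Longrightarrow> X = G"
    using subset_Zorn_nonempty[of F] by blast
  have G: "rmod_linrel R B E G" and G0: "G0 \<subseteq> G"
    using GF by (auto simp: F_def)
  have total: "\<exists>y. (b, y) \<in> G" if "b \<in> carrier B" for b
  proof -
    obtain G' where "rmod_linrel R B E G'" "G \<subseteq> G'" "b \<in> fst ` G'"
      using rmod_linrel_extend[OF inj B G \<open>b \<in> carrier B\<close>] by blast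
    moreover from this have "G' = G"
      using G0 by (intro max) (auto simp: F_def)
    ultimately show ?thesis by force
  qed
  define k where "k b = (THE y. (b, y) \<in> G)" for b
  have k_eq: "k b = y" if "(b, y) \<in> G" for b y
    unfolding k_def using that rmod_linrel_unique[OF B E G] by blast
  have k_mem: "(b, k b) \<in> G" if "b \<in> carrier B" for b
    using total[OF that] k_eq by blast
  have "k \<in> rmod_hom R B E"
  proof (rule rmod_homI)
    show "k x \<in> carrier E" if "x \<in> carrier B" for x
      using k_mem[OF that] G by (auto simp: rmod_linrel_def)
    show "k (x \<oplus>\<^bsub>B\<^esub> y) = k x \<oplus>\<^bsub>E\<^esub> k y" if "x \<in> carrier B" "y \<in> carrier B" for x y
      using k_mem[OF that(1)] k_mem[OF that(2)] G by (intro k_eq) (simp add: rmod_linrel_def)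
    show "k (x \<cdot>\<^bsub>B\<^esub> r) = k x \<cdot>\<^bsub>E\<^esub> r" if "x \<in> carrier B" "r \<in> carrier R" for x r
      using k_mem[OF that(1)] that(2) G by (intro k_eq) (simp add: rmod_linrel_def)
  qed
  moreover have "k (i a) = h a" if "a \<in> carrier A" for a
    using that G0 by (intro k_eq) (auto simp: G0_def)
  ultimately show ?thesis by blast
qed

end

theory Submission
  imports Defs "HOL-Algebra.AbelCoset"
begin

text \<open>Let \<open>E\<close> be the injective envelope of an automorphism-invariant module \<open>L\<close>. The endomorphisms
  of \<open>E\<close> that preserve \<open>L\<close> form a ring containing all automorphisms, hence also every \<open>h\<close> with
  \<open>h\<^sup>2 = 0\<close> and every \<open>h\<close> with essential kernel, since \<open>1 + h\<close> is then an automorphism. Every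
  monomorphism from a submodule \<open>A\<close> of \<open>E\<close> into \<open>E\<close> is the restriction of an element of this ring:
  up to essential extension, \<open>A\<close> is the direct sum of three submodules \<open>C\<close> that have a copy meeting
  \<open>C\<close> trivially, where nilpotent endomorphisms suffice, and of a submodule \<open>B\<close> containing no
  nonzero such \<open>C\<close>, on which the monomorphism extends to an automorphism. Consequently every
  monomorphism from a submodule of \<open>L\<close> to \<open>E\<close> has its image in \<open>L\<close>.

  If \<open>M\<close> and \<open>N\<close> embed into each other, Bumby's argument gives an isomorphism \<open>\<Theta>\<close> of their
  envelopes. It maps \<open>M\<close> into \<open>N\<close>, as \<open>M\<close> is isomorphic to the submodule \<open>f M\<close> of \<open>N\<close>, and
  likewise its inverse maps \<open>N\<close> into \<open>M\<close>.\<close>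

section \<open>Submodules and homomorphisms\<close>

context right_module
begin

abbreviation submod :: "'m set \<Rightarrow> bool" where
  "submod K \<equiv> right_submodule K R M"

text \<open>Closure under negation follows from closure under the scalar -1.\<close>

lemma submodI:
  assumes "K \<subseteq> carrier M" "\<zero> \<in> K"
    and "\<And>x y. \<lbrakk>x \<in> K; y \<in> K\<rbrakk> \<Longrightarrow> x \<oplus> y \<in> K"
    and "\<And>x r. \<lbrakk>x \<in> K; r \<in> carrier R\<rbrakk> \<Longrightarrow> x \<cdot> r \<in> K"
  shows "submod K"
proof -
  have "\<ominus> x \<in> K" if "x \<in> K" for x
    using assms that by (metis R.add.inv_closed R.one_closed minus_eq_rsmult subsetD)
  then show ?thesis
    using assms unfolding right_submodule_def
    by (auto intro!: subgroup.intro simp: a_inv_def[symmetric])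
qed

lemma submodD:
  assumes "submod K"
  shows submod_mem: "x \<in> K \<Longrightarrow> x \<in> carrier M"
    and submod_subset: "K \<subseteq> carrier M"
    and submod_zero: "\<zero> \<in> K"
    and submod_add: "\<lbrakk>x \<in> K; y \<in> K\<rbrakk> \<Longrightarrow> x \<oplus> y \<in> K"
    and submod_neg: "x \<in> K \<Longrightarrow> \<ominus> x \<in> K"
    and submod_minus: "\<lbrakk>x \<in> K; y \<in> K\<rbrakk> \<Longrightarrow> x \<ominus> y \<in> K"
    and submod_smult: "\<lbrakk>x \<in> K; r \<in> carrier R\<rbrakk> \<Longrightarrow> x \<cdot> r \<in> K"
proof -
  have sg: "subgroup K (add_monoid M)"
    and sm: "\<And>x r. \<lbrakk>x \<in> K; r \<in> carrier R\<rbrakk> \<Longrightarrow> x \<cdot> r \<in> K"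
    using assms by (auto simp: right_submodule_def)
  show 1: "x \<in> K \<Longrightarrow> x \<in> carrier M" "K \<subseteq> carrier M" "\<zero> \<in> K"
    and 2: "\<And>x y. \<lbrakk>x \<in> K; y \<in> K\<rbrakk> \<Longrightarrow> x \<oplus> y \<in> K"
    using subgroup.subset[OF sg] subgroup.one_closed[OF sg] subgroup.m_closed[OF sg] by auto
  show 3: "\<And>x. x \<in> K \<Longrightarrow> \<ominus> x \<in> K"
    using subgroup.m_inv_closed[OF sg] by (simp add: a_inv_def)
  show "\<lbrakk>x \<in> K; y \<in> K\<rbrakk> \<Longrightarrow> x \<ominus> y \<in> K"
    using 2 3 by (simp add: a_minus_def)
  show "\<lbrakk>x \<in> K; r \<in> carrier R\<rbrakk> \<Longrightarrow> x \<cdot> r \<in> K"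
    by (rule sm)
qed

lemma rsmult_zero_left: "r \<in> carrier R \<Longrightarrow> \<zero> \<cdot> r = \<zero>"
  using rsmult_assoc[of \<zero> "\<zero>\<^bsub>R\<^esub>" r] by (simp add: rsmult_zero)

lemma submod_carrier [simp]: "submod (carrier M)"
  by (rule submodI) auto

lemma submod_0 [simp]: "submod {\<zero>}"
  by (rule submodI) (auto simp: rsmult_zero_left)

lemma submod_Int: "\<lbrakk>submod K; submod L\<rbrakk> \<Longrightarrow> submod (K \<inter> L)"
  by (intro submodI) (auto dest: submodD)

lemma msum_iff: "z \<in> K <+>\<^bsub>M\<^esub> L \<longleftrightarrow> (\<exists>x\<in>K. \<exists>y\<in>L. z = x \<oplus> y)"
  by (auto simp: set_add_def')

lemma msumI: "\<lbrakk>x \<in> K; y \<in> L\<rbrakk> \<Longrightarrow> x \<oplus> y \<in> K <+>\<^bsub>M\<^esub> L"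
  by (auto simp: msum_iff)

lemma submod_msum:
  assumes "submod K" "submod L"
  shows "submod (K <+>\<^bsub>M\<^esub> L)"
proof (rule submodI)
  note K = submodD[OF assms(1)] and L = submodD[OF assms(2)]
  show "K <+>\<^bsub>M\<^esub> L \<subseteq> carrier M"
    using K L by (auto simp: msum_iff)
  show "\<zero> \<in> K <+>\<^bsub>M\<^esub> L"
    using msumI[OF K(3) L(3)] by simp
  show "x \<cdot> r \<in> K <+>\<^bsub>M\<^esub> L" if "x \<in> K <+>\<^bsub>M\<^esub> L" "r \<in> carrier R" for x r
  proof -
    obtain k l where "k \<in> K" "l \<in> L" "x = k \<oplus> l" using \<open>x \<in> _\<close> by (auto simp: msum_iff)
    then show ?thesis using that K L by (auto simp: rsmult_l_distr intro!: msumI)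
  qed
  fix x y assume "x \<in> K <+>\<^bsub>M\<^esub> L" "y \<in> K <+>\<^bsub>M\<^esub> L"
  then obtain k l k' l' where *: "k \<in> K" "l \<in> L" "k' \<in> K" "l' \<in> L" "x = k \<oplus> l" "y = k' \<oplus> l'"
    by (auto simp: msum_iff)
  then have "x \<oplus> y = (k \<oplus> k') \<oplus> (l \<oplus> l')"
    using K L by (simp add: M.a_ac)
  then show "x \<oplus> y \<in> K <+>\<^bsub>M\<^esub> L"
    using * K L by (auto intro: msumI)
qed

lemma msum_left:
  assumes "submod K" "submod L" shows "K \<subseteq> K <+>\<^bsub>M\<^esub> L"
proof
  fix x assume "x \<in> K"
  then show "x \<in> K <+>\<^bsub>M\<^esub> L"
    using msumI[of x K \<zero> L] submodD[OF assms(1)] submodD[OF assms(2)] by simp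
qed

lemma msum_right:
  assumes "submod K" "submod L" shows "L \<subseteq> K <+>\<^bsub>M\<^esub> L"
proof
  fix x assume "x \<in> L"
  then show "x \<in> K <+>\<^bsub>M\<^esub> L"
    using msumI[of \<zero> K x L] submodD[OF assms(1)] submodD[OF assms(2)] by simp
qed

lemma msum_least: "\<lbrakk>submod X; K \<subseteq> X; L \<subseteq> X\<rbrakk> \<Longrightarrow> K <+>\<^bsub>M\<^esub> L \<subseteq> X"
  by (auto simp: msum_iff intro!: submod_add dest: subsetD)

lemma add_eq_add_imp:
  assumes "x \<in> carrier M" "y \<in> carrier M" "x' \<in> carrier M" "y' \<in> carrier M" "x \<oplus> y = x' \<oplus> y'"
  shows "x \<ominus> x' = y' \<ominus> y"
proof -
  have "x \<ominus> x' = (x \<oplus> y) \<oplus> (\<ominus> y \<oplus> \<ominus> x')"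
    using assms(1-4) by (simp add: a_minus_def M.a_assoc M.r_neg2)
  also have "\<dots> = x' \<oplus> (\<ominus> x' \<oplus> (y' \<oplus> \<ominus> y))"
    unfolding assms(5) using assms(1-4) by (simp add: M.a_ac)
  also have "\<dots> = y' \<ominus> y"
    using assms(1-4) by (simp add: a_minus_def M.r_neg2)
  finally show ?thesis .
qed

lemma minus_eq_zero_iff: "\<lbrakk>x \<in> carrier M; y \<in> carrier M\<rbrakk> \<Longrightarrow> x \<ominus> y = \<zero> \<longleftrightarrow> x = y"
  by (metis M.add.inv_solve_right' M.l_zero M.zero_closed a_minus_def)

text \<open>The difference of the two decompositions lies in both \<open>K\<close> and
  \<open>L\<close>.\<close>

lemma direct_unique:
  assumes "submod K" "submod L" "K \<inter> L \<subseteq> {\<zero>}" "x \<in> K" "x' \<in> K" "y \<in> L" "y' \<in> L"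
    and "x \<oplus> y = x' \<oplus> y'"
  shows "x = x' \<and> y = y'"
proof -
  note K = submodD[OF assms(1)] and L = submodD[OF assms(2)]
  have "x \<ominus> x' = y' \<ominus> y"
    using assms K L by (intro add_eq_add_imp) auto
  moreover have "x \<ominus> x' \<in> K" "y' \<ominus> y \<in> L"
    using assms K L by auto
  ultimately have "x \<ominus> x' = \<zero>" "y' \<ominus> y = \<zero>"
    using assms(3) by auto
  then show ?thesis
    using assms K L by (simp add: minus_eq_zero_iff)
qed

lemma direct_zero:
  assumes "submod K" "submod L" "K \<inter> L \<subseteq> {\<zero>}" "x \<in> K" "y \<in> L" "x \<oplus> y = \<zero>"
  shows "x = \<zero> \<and> y = \<zero>"
  using direct_unique[OF assms(1-3), of x \<zero> y \<zero>] assms submod_zero by auto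

lemma submod_Union_chain:
  assumes "C \<noteq> {}" "subset.chain F C" "\<And>K. K \<in> C \<Longrightarrow> submod K"
  shows "submod (\<Union>C)"
proof (rule submodI)
  show "\<Union>C \<subseteq> carrier M" "\<zero> \<in> \<Union>C"
    using assms submod_subset submod_zero by blast+
  show "x \<cdot> r \<in> \<Union>C" if "x \<in> \<Union>C" "r \<in> carrier R" for x r
    using that assms(3) submod_smult by blast
  fix x y assume "x \<in> \<Union>C" "y \<in> \<Union>C"
  then obtain K where "K \<in> C" "x \<in> K" "y \<in> K"
    using assms(2) unfolding subset_chain_def by blast
  then show "x \<oplus> y \<in> \<Union>C"
    using assms(3) submod_add by blast
qed

lemma submod_right_module:
  assumes "submod K" shows "right_module R (M\<lparr>carrier := K\<rparr>)"
proof (intro right_module.intro right_module_axioms.intro abelian_groupI)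
  note K = submodD[OF assms]
  show "ring R" by (rule R.ring_axioms)
  show "\<exists>y\<in>carrier (M\<lparr>carrier := K\<rparr>). y \<oplus>\<^bsub>M\<lparr>carrier := K\<rparr>\<^esub> x = \<zero>\<^bsub>M\<lparr>carrier := K\<rparr>\<^esub>"
    if "x \<in> carrier (M\<lparr>carrier := K\<rparr>)" for x
    using that K by (auto intro!: bexI[of _ "\<ominus> x"] M.l_neg)
qed (use submodD[OF assms] in \<open>auto simp: M.a_ac rsmult_l_distr rsmult_r_distr rsmult_assoc\<close>)

lemma submod_cyclic:
  assumes "a \<in> carrier M" shows "submod ((\<lambda>r. a \<cdot> r) ` carrier R)"
proof (rule submodI)
  show "\<zero> \<in> (\<lambda>r. a \<cdot> r) ` carrier R"
    using assms by (auto intro!: image_eqI[of _ _ "\<zero>\<^bsub>R\<^esub>"] simp: rsmult_zero)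
  show "x \<oplus> y \<in> (\<lambda>r. a \<cdot> r) ` carrier R"
    if xy: "x \<in> (\<lambda>r. a \<cdot> r) ` carrier R" "y \<in> (\<lambda>r. a \<cdot> r) ` carrier R" for x y
  proof -
    obtain r s where "r \<in> carrier R" "s \<in> carrier R" "x = a \<cdot> r" "y = a \<cdot> s"
      using xy by auto
    then show ?thesis
      using assms by (auto intro!: image_eqI[of _ _ "r \<oplus>\<^bsub>R\<^esub> s"] simp: rsmult_r_distr)
  qed
  show "x \<cdot> s \<in> (\<lambda>r. a \<cdot> r) ` carrier R"
    if x: "x \<in> (\<lambda>r. a \<cdot> r) ` carrier R" and s: "s \<in> carrier R" for x s
  proof -
    obtain r where "r \<in> carrier R" "x = a \<cdot> r" using x by auto
    then show ?thesis
      using assms s by (auto intro!: image_eqI[of _ _ "r \<otimes>\<^bsub>R\<^esub> s"] simp: rsmult_assoc)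
  qed
qed (use assms in auto)

section \<open>Essential submodules and relative complements\<close>

definition ess :: "'m set \<Rightarrow> 'm set \<Rightarrow> bool" where
  "ess D A \<longleftrightarrow> (\<forall>a\<in>A. a \<noteq> \<zero> \<longrightarrow> (\<exists>r\<in>carrier R. a \<cdot> r \<in> D \<and> a \<cdot> r \<noteq> \<zero>))"

text \<open>\<open>ess\<close> is phrased through elements and relative to a submodule
  \<open>A\<close>, so that transitivity and sums become computations with scalars. The usual
  condition, tested on the cyclic submodule generated by \<open>a\<close>, yields the
  scalar.\<close>

lemma essI:
  assumes "submod A" "submod D"
    and "\<And>X. \<lbrakk>submod X; X \<subseteq> A; X \<inter> D \<subseteq> {\<zero>}\<rbrakk> \<Longrightarrow> X \<subseteq> {\<zero>}"
  shows "ess D A"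
  unfolding ess_def
proof (intro ballI impI)
  fix a assume a: "a \<in> A" "a \<noteq> \<zero>"
  then have ac: "a \<in> carrier M" using submod_mem[OF assms(1)] by blast
  let ?X = "(\<lambda>r. a \<cdot> r) ` carrier R"
  have "a \<in> ?X"
    using ac by (auto intro!: image_eqI[of _ _ "\<one>\<^bsub>R\<^esub>"])
  then have "\<not> ?X \<subseteq> {\<zero>}" using a by auto
  then have "\<not> ?X \<inter> D \<subseteq> {\<zero>}"
    using assms(3)[of ?X] submod_cyclic[OF ac] submod_smult[OF assms(1)] a by blast
  then show "\<exists>r\<in>carrier R. a \<cdot> r \<in> D \<and> a \<cdot> r \<noteq> \<zero>" by blast
qed

lemma essD:
  assumes "ess D A" "submod X" "X \<subseteq> A" "X \<inter> D \<subseteq> {\<zero>}"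
  shows "X \<subseteq> {\<zero>}"
proof
  fix x assume x: "x \<in> X"
  show "x \<in> {\<zero>}"
  proof (rule ccontr)
    assume "x \<notin> {\<zero>}"
    then obtain r where "r \<in> carrier R" "x \<cdot> r \<in> D" "x \<cdot> r \<noteq> \<zero>"
      using assms(1,3) x unfolding ess_def by blast
    then show False
      using assms(2,4) x submod_smult by blast
  qed
qed

lemma essential_in_iff: "essential_in L R M \<longleftrightarrow> submod L \<and> ess L (carrier M)"
proof
  assume L: "essential_in L R M"
  show "submod L \<and> ess L (carrier M)"
  proof (intro conjI essI)
    show *: "submod L" "submod L" using L by (auto simp: essential_in_def)
    fix X assume "submod X" "X \<inter> L \<subseteq> {\<zero>}"
    moreover from this have "L \<inter> X = {\<zero>}" using * submod_zero by blast
    ultimately show "X \<subseteq> {\<zero>}" using L by (auto simp: essential_in_def)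
  qed auto
next
  assume L: "submod L \<and> ess L (carrier M)"
  show "essential_in L R M"
    unfolding essential_in_def
  proof (intro conjI allI impI)
    fix K assume K: "submod K \<and> L \<inter> K = {\<zero>}"
    then have "K \<subseteq> {\<zero>}" using L submod_subset[of K] by (intro essD[of L "carrier M" K]) auto
    then show "K = {\<zero>}" using K by blast
  qed (use L in auto)
qed

lemma ess_refl: "submod A \<Longrightarrow> ess A A"
  unfolding ess_def using submod_mem by (metis R.one_closed rsmult_one)

lemma ess_trans:
  assumes "ess D B" "ess B A" "submod A"
  shows "ess D A"
  unfolding ess_def
proof (intro ballI impI)
  fix a assume a: "a \<in> A" "a \<noteq> \<zero>"
  then obtain r where r: "r \<in> carrier R" "a \<cdot> r \<in> B" "a \<cdot> r \<noteq> \<zero>"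
    using assms(2) unfolding ess_def by blast
  then obtain s where "s \<in> carrier R" "a \<cdot> r \<cdot> s \<in> D" "a \<cdot> r \<cdot> s \<noteq> \<zero>"
    using assms(1) unfolding ess_def by blast
  then show "\<exists>r\<in>carrier R. a \<cdot> r \<in> D \<and> a \<cdot> r \<noteq> \<zero>"
    using r a submod_mem[OF assms(3)] by (intro bexI[of _ "r \<otimes>\<^bsub>R\<^esub> s"]) (auto simp: rsmult_assoc)
qed

text \<open>An element \<open>a \<oplus> b\<close> is moved into \<open>C + D\<close> in two rounds:
  one scalar takes the \<open>B\<close>-component into \<open>D\<close>, a second takes what is left
  of the \<open>A\<close>-component into \<open>C\<close>. Directness of \<open>A + B\<close> keeps
  a product nonzero as soon as one of its components is.\<close>

lemma ess_msum:
  assumes A: "submod A" "submod B" "A \<inter> B \<subseteq> {\<zero>}" and C: "submod C" "submod D" "C \<subseteq> A" "D \<subseteq> B"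
    and "ess C A" "ess D B"
  shows "ess (C <+>\<^bsub>M\<^esub> D) (A <+>\<^bsub>M\<^esub> B)"
  unfolding ess_def
proof (intro ballI impI)
  fix x assume "x \<in> A <+>\<^bsub>M\<^esub> B" "x \<noteq> \<zero>"
  then obtain a b where x: "a \<in> A" "b \<in> B" "x = a \<oplus> b" "a \<oplus> b \<noteq> \<zero>"
    by (auto simp: msum_iff)
  note mem = submod_mem[OF A(1) x(1)] submod_mem[OF A(2) x(2)]
  note nz = direct_zero[OF A]
  have 1: "\<exists>r\<in>carrier R. b \<cdot> r \<in> D \<and> x \<cdot> r \<noteq> \<zero>"
  proof (cases "b = \<zero>")
    case True
    then show ?thesis
      using x mem submod_zero[OF C(2)] by (intro bexI[of _ "\<one>\<^bsub>R\<^esub>"]) auto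
  next
    case False
    then obtain r where r: "r \<in> carrier R" "b \<cdot> r \<in> D" "b \<cdot> r \<noteq> \<zero>"
      using \<open>ess D B\<close> x unfolding ess_def by blast
    then have "x \<cdot> r \<noteq> \<zero>"
      using nz[of "a \<cdot> r" "b \<cdot> r"] x mem submod_smult[OF A(1)] submod_smult[OF A(2)]
      by (auto simp: rsmult_l_distr)
    then show ?thesis using r by blast
  qed
  then obtain r where r: "r \<in> carrier R" "b \<cdot> r \<in> D" "x \<cdot> r \<noteq> \<zero>" by blast
  have xr: "x \<cdot> r = a \<cdot> r \<oplus> b \<cdot> r"
    using x mem r by (auto simp: rsmult_l_distr)
  have ar: "a \<cdot> r \<in> A" using x r submod_smult[OF A(1)] by auto
  show "\<exists>r\<in>carrier R. x \<cdot> r \<in> C <+>\<^bsub>M\<^esub> D \<and> x \<cdot> r \<noteq> \<zero>"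
  proof (cases "a \<cdot> r = \<zero>")
    case True
    then have "x \<cdot> r \<in> C <+>\<^bsub>M\<^esub> D"
      using xr r submod_zero[OF C(1)] by (auto intro: msumI)
    then show ?thesis using r by blast
  next
    case False
    then obtain s where s: "s \<in> carrier R" "a \<cdot> r \<cdot> s \<in> C" "a \<cdot> r \<cdot> s \<noteq> \<zero>"
      using \<open>ess C A\<close> ar unfolding ess_def by blast
    have bs: "b \<cdot> r \<cdot> s \<in> D" using s r submod_smult[OF C(2)] by auto
    have eq: "x \<cdot> (r \<otimes>\<^bsub>R\<^esub> s) = a \<cdot> r \<cdot> s \<oplus> b \<cdot> r \<cdot> s"
      using x mem r s by (simp add: rsmult_assoc xr rsmult_l_distr)
    have "x \<cdot> (r \<otimes>\<^bsub>R\<^esub> s) \<noteq> \<zero>"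
      using nz[of "a \<cdot> r \<cdot> s" "b \<cdot> r \<cdot> s"] s bs C eq by auto
    then show ?thesis
      using eq s bs r by (intro bexI[of _ "r \<otimes>\<^bsub>R\<^esub> s"]) (auto intro: msumI)
  qed
qed

text \<open>Zorn's lemma: containment in \<open>A\<close> and independence of \<open>C\<close> pass
  to unions of chains. Prescribing \<open>B\<close> allows a complement to be chosen above a given
  submodule.\<close>

lemma complement_exists:
  assumes A: "submod A" and B: "submod B" "B \<subseteq> A" and C: "submod C" "B \<inter> C \<subseteq> {\<zero>}"
  obtains W where "submod W" "B \<subseteq> W" "W \<subseteq> A" "W \<inter> C = {\<zero>}"
    and "\<And>X. \<lbrakk>submod X; W \<subseteq> X; X \<subseteq> A; X \<inter> C \<subseteq> {\<zero>}\<rbrakk> \<Longrightarrow> X = W"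
proof -
  define F where "F = {W. submod W \<and> B \<subseteq> W \<and> W \<subseteq> A \<and> W \<inter> C \<subseteq> {\<zero>}}"
  have "B \<in> F" using assms by (auto simp: F_def)
  moreover have "\<Union>\<C> \<in> F" if "\<C> \<noteq> {}" "subset.chain F \<C>" for \<C>
  proof -
    have *: "submod W \<and> B \<subseteq> W \<and> W \<subseteq> A \<and> W \<inter> C \<subseteq> {\<zero>}" if "W \<in> \<C>" for W
      using that \<open>subset.chain F \<C>\<close> by (auto simp: subset.chain_def F_def)
    have "submod (\<Union>\<C>)"
      using * by (intro submod_Union_chain[OF that]) auto
    then show ?thesis using * \<open>\<C> \<noteq> {}\<close> unfolding F_def by blast
  qed
  ultimately obtain W where W: "W \<in> F" "\<And>X. X \<in> F \<Longrightarrow> W \<subseteq> X \<Longrightarrow> X = W"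
    using subset_Zorn_nonempty[of F] by blast
  have W': "submod W" "B \<subseteq> W" "W \<subseteq> A" "W \<inter> C \<subseteq> {\<zero>}"
    using W(1) by (auto simp: F_def)
  show thesis
  proof (rule that[OF W'(1-3)])
    show "W \<inter> C = {\<zero>}"
      using W' submod_zero[OF W'(1)] submod_zero[OF C(1)] by blast
    show "X = W" if "submod X" "W \<subseteq> X" "X \<subseteq> A" "X \<inter> C \<subseteq> {\<zero>}" for X
      using that W' W(2)[of X] by (auto simp: F_def)
  qed
qed

text \<open>A maximal \<open>W\<close> works: if \<open>X\<close> misses \<open>C + W\<close>, then
  \<open>X + W\<close> still misses \<open>C\<close>, so maximality puts \<open>X\<close> inside
  \<open>W\<close>.\<close>

lemma ess_complement_exists:
  assumes A: "submod A" and C: "submod C" "C \<subseteq> A"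
  obtains W where "submod W" "W \<subseteq> A" "W \<inter> C = {\<zero>}" "ess (C <+>\<^bsub>M\<^esub> W) A"
proof -
  have "{\<zero>} \<subseteq> A" "{\<zero>} \<inter> C \<subseteq> {\<zero>}"
    using submod_zero[OF A] by auto
  then obtain W where W: "submod W" "{\<zero>} \<subseteq> W" "W \<subseteq> A" "W \<inter> C = {\<zero>}"
    and max: "\<And>X. \<lbrakk>submod X; W \<subseteq> X; X \<subseteq> A; X \<inter> C \<subseteq> {\<zero>}\<rbrakk> \<Longrightarrow> X = W"
    using complement_exists[OF A submod_0 _ C(1)] by metis
  have "ess (C <+>\<^bsub>M\<^esub> W) A"
  proof (rule essI[OF A submod_msum[OF C(1) W(1)]])
    fix X assume X: "submod X" "X \<subseteq> A" "X \<inter> (C <+>\<^bsub>M\<^esub> W) \<subseteq> {\<zero>}"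
    have "(X <+>\<^bsub>M\<^esub> W) \<inter> C \<subseteq> {\<zero>}"
    proof
      fix c assume "c \<in> (X <+>\<^bsub>M\<^esub> W) \<inter> C"
      then obtain x w where *: "x \<in> X" "w \<in> W" "c \<in> C" "c = x \<oplus> w" by (auto simp: msum_iff)
      note mem = submod_mem[OF X(1) *(1)] submod_mem[OF W(1) *(2)]
      have "x = c \<oplus> \<ominus> w"
        using mem *(4) by (simp add: M.a_assoc M.r_neg)
      then have "x \<in> C <+>\<^bsub>M\<^esub> W"
        using msumI[OF *(3) submod_neg[OF W(1) *(2)]] by simp
      then have "x = \<zero>" using X * by blast
      then show "c \<in> {\<zero>}" using * mem W(4) by auto
    qed
    then have "X <+>\<^bsub>M\<^esub> W = W"
      using X W A by (intro max submod_msum msum_least msum_right) auto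
    then have "X \<subseteq> W" using msum_left[OF X(1) W(1)] by simp
    then show "X \<subseteq> {\<zero>}"
      using X(3) msum_right[OF C(1) W(1)] by blast
  qed
  then show thesis using W that by blast
qed

end

section \<open>Kernels, images and preimages of homomorphisms\<close>

lemma rmod_hom_zero:
  assumes "right_module R A" "right_module R B" "h \<in> rmod_hom R A B"
  shows "h \<zero>\<^bsub>A\<^esub> = \<zero>\<^bsub>B\<^esub>"
proof -
  interpret A: right_module R A by fact
  interpret B: right_module R B by fact
  show ?thesis
    using rmod_homD(3)[OF assms(3), of "\<zero>\<^bsub>A\<^esub>" "\<zero>\<^bsub>R\<^esub>"] rmod_homD(1)[OF assms(3), of "\<zero>\<^bsub>A\<^esub>"]
    by (simp add: A.rsmult_zero B.rsmult_zero)
qed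

lemma rmod_hom_minus:
  assumes "right_module R A" "right_module R B" "h \<in> rmod_hom R A B"
    and "x \<in> carrier A" "y \<in> carrier A"
  shows "h (x \<ominus>\<^bsub>A\<^esub> y) = h x \<ominus>\<^bsub>B\<^esub> h y"
proof -
  interpret A: right_module R A by fact
  interpret B: right_module R B by fact
  note h = rmod_homD[OF assms(3)]
  have "h (\<ominus>\<^bsub>A\<^esub> y) = \<ominus>\<^bsub>B\<^esub> h y"
    using assms h(3)[of y "\<ominus>\<^bsub>R\<^esub> \<one>\<^bsub>R\<^esub>"] h(1)[of y]
    by (simp add: A.minus_eq_rsmult B.minus_eq_rsmult)
  then show ?thesis
    using assms h by (simp add: a_minus_def)
qed

lemma rmod_hom_inj_onI:
  assumes "right_module R A" "right_module R B" "h \<in> rmod_hom R A B" "right_submodule K R A"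
    and "\<And>x. \<lbrakk>x \<in> K; h x = \<zero>\<^bsub>B\<^esub>\<rbrakk> \<Longrightarrow> x = \<zero>\<^bsub>A\<^esub>"
  shows "inj_on h K"
proof (rule inj_onI)
  interpret A: right_module R A by fact
  interpret B: right_module R B by fact
  fix x y assume xy: "x \<in> K" "y \<in> K" "h x = h y"
  note K = A.submodD[OF assms(4)]
  have "h (x \<ominus>\<^bsub>A\<^esub> y) = \<zero>\<^bsub>B\<^esub>"
    using rmod_hom_minus[OF assms(1-3), of x y] rmod_homD(1)[OF assms(3), of y] xy K
    by (simp add: B.minus_eq_zero_iff)
  then have "x \<ominus>\<^bsub>A\<^esub> y = \<zero>\<^bsub>A\<^esub>" using assms(5)[OF K(6)] xy by simp
  then show "x = y" using xy K by (simp add: A.minus_eq_zero_iff)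
qed

lemma rmod_hom_inj_onD:
  assumes "right_module R A" "right_module R B" "h \<in> rmod_hom R A B" "right_submodule K R A"
    and "inj_on h K" "x \<in> K" "h x = \<zero>\<^bsub>B\<^esub>"
  shows "x = \<zero>\<^bsub>A\<^esub>"
  using assms rmod_hom_zero[OF assms(1-3)] right_module.submod_zero[OF assms(1,4)]
  by (metis inj_onD)

lemma rmod_hom_compose:
  assumes "h \<in> rmod_hom R A B" "k \<in> rmod_hom R B C"
  shows "(\<lambda>x. k (h x)) \<in> rmod_hom R A C"
  using rmod_homD[OF assms(1)] rmod_homD[OF assms(2)] by (intro rmod_homI) auto

lemma rmod_hom_id: "(\<lambda>x. x) \<in> rmod_hom R A A"
  by (intro rmod_homI) auto

lemma rmod_hom_const_zero:
  assumes "right_module R B"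
  shows "(\<lambda>x. \<zero>\<^bsub>B\<^esub>) \<in> rmod_hom R A B"
proof -
  interpret B: right_module R B by fact
  show ?thesis by (intro rmod_homI) (auto simp: B.rsmult_zero_left)
qed

lemma rmod_hom_add:
  assumes "right_module R B" "h \<in> rmod_hom R A B" "k \<in> rmod_hom R A B"
  shows "(\<lambda>x. h x \<oplus>\<^bsub>B\<^esub> k x) \<in> rmod_hom R A B"
proof -
  interpret B: right_module R B by fact
  show ?thesis
    using rmod_homD[OF assms(2)] rmod_homD[OF assms(3)]
    by (intro rmod_homI) (auto simp: B.M.a_ac B.rsmult_l_distr)
qed

lemma rmod_hom_diff:
  assumes "right_module R B" "h \<in> rmod_hom R A B" "k \<in> rmod_hom R A B"
  shows "(\<lambda>x. h x \<ominus>\<^bsub>B\<^esub> k x) \<in> rmod_hom R A B"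
proof -
  interpret B: right_module R B by fact
  have "(x \<oplus>\<^bsub>B\<^esub> y) \<ominus>\<^bsub>B\<^esub> (z \<oplus>\<^bsub>B\<^esub> w) = (x \<ominus>\<^bsub>B\<^esub> z) \<oplus>\<^bsub>B\<^esub> (y \<ominus>\<^bsub>B\<^esub> w)"
    if "x \<in> carrier B" "y \<in> carrier B" "z \<in> carrier B" "w \<in> carrier B" for x y z w
    using that by (simp add: a_minus_def B.M.minus_add B.M.a_ac)
  moreover have "(x \<ominus>\<^bsub>B\<^esub> y) \<cdot>\<^bsub>B\<^esub> r = x \<cdot>\<^bsub>B\<^esub> r \<ominus>\<^bsub>B\<^esub> y \<cdot>\<^bsub>B\<^esub> r"
    if "x \<in> carrier B" "y \<in> carrier B" "r \<in> carrier R" for x y r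
  proof -
    have "\<ominus>\<^bsub>B\<^esub> y \<cdot>\<^bsub>B\<^esub> r = \<ominus>\<^bsub>B\<^esub> (y \<cdot>\<^bsub>B\<^esub> r)"
      using that B.rsmult_assoc[of y "\<ominus>\<^bsub>R\<^esub> \<one>\<^bsub>R\<^esub>" r] B.rsmult_minus[of y r]
      by (simp add: B.minus_eq_rsmult B.R.l_minus)
    then show ?thesis using that by (simp add: a_minus_def B.rsmult_l_distr)
  qed
  ultimately show ?thesis
    using rmod_homD[OF assms(2)] rmod_homD[OF assms(3)]
    by (intro rmod_homI) auto
qed

lemma rmod_hom_restrict:
  assumes "h \<in> rmod_hom R A B" "K \<subseteq> carrier A"
  shows "h \<in> rmod_hom R (A\<lparr>carrier := K\<rparr>) B"
  using rmod_homD[OF assms(1)] assms(2) by (intro rmod_homI) (simp_all add: subset_iff)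

lemma submod_image:
  assumes "right_module R A" "right_module R B" "h \<in> rmod_hom R (A\<lparr>carrier := K\<rparr>) B"
    and "right_submodule K R A"
  shows "right_submodule (h ` K) R B"
proof -
  interpret A: right_module R A by fact
  interpret B: right_module R B by fact
  note h = rmod_homD[OF assms(3), simplified] and K = A.submodD[OF assms(4)]
  have "h \<zero>\<^bsub>A\<^esub> = \<zero>\<^bsub>B\<^esub>"
    using rmod_hom_zero[OF A.submod_right_module[OF assms(4)] assms(2,3)] by simp
  then show ?thesis
    using K by (intro B.submodI) (auto simp: h(1) h(2)[symmetric] h(3)[symmetric] intro: rev_image_eqI)
qed

lemma submod_vimage:
  assumes "right_module R A" "right_module R B" "h \<in> rmod_hom R A B"
    and "right_submodule K R A" "right_submodule L R B"
  shows "right_submodule {x \<in> K. h x \<in> L} R A"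
proof -
  interpret A: right_module R A by fact
  interpret B: right_module R B by fact
  note h = rmod_homD[OF assms(3)] and K = A.submodD[OF assms(4)] and L = B.submodD[OF assms(5)]
  show ?thesis
    using rmod_hom_zero[OF assms(1-3)] h K L
    by (intro A.submodI) auto
qed

section \<open>Extending partial homomorphisms given by graphs\<close>

text \<open>Its submodules serve as graphs of partial homomorphisms from \<open>B\<close> to
  \<open>E\<close>.\<close>

definition rmod_prod ::
    "('r, 'b) right_module \<Rightarrow> ('r, 'e) right_module \<Rightarrow> ('r, 'b \<times> 'e) right_module" where
  "rmod_prod B E =
     \<lparr>carrier = carrier B \<times> carrier E, mult = undefined, one = undefined,
      zero = (\<zero>\<^bsub>B\<^esub>, \<zero>\<^bsub>E\<^esub>), add = (\<lambda>p q. (fst p \<oplus>\<^bsub>B\<^esub> fst q, snd p \<oplus>\<^bsub>E\<^esub> snd q)),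
      rsmult = (\<lambda>p r. (fst p \<cdot>\<^bsub>B\<^esub> r, snd p \<cdot>\<^bsub>E\<^esub> r))\<rparr>"

lemma rmod_prod_simps [simp]:
  "carrier (rmod_prod B E) = carrier B \<times> carrier E"
  "\<zero>\<^bsub>rmod_prod B E\<^esub> = (\<zero>\<^bsub>B\<^esub>, \<zero>\<^bsub>E\<^esub>)"
  "p \<oplus>\<^bsub>rmod_prod B E\<^esub> q = (fst p \<oplus>\<^bsub>B\<^esub> fst q, snd p \<oplus>\<^bsub>E\<^esub> snd q)"
  "p \<cdot>\<^bsub>rmod_prod B E\<^esub> r = (fst p \<cdot>\<^bsub>B\<^esub> r, snd p \<cdot>\<^bsub>E\<^esub> r)"
  by (simp_all add: rmod_prod_def)

lemma right_module_rmod_prod: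
  assumes "right_module R B" "right_module R E"
  shows "right_module R (rmod_prod B E)"
proof -
  interpret B: right_module R B by fact
  interpret E: right_module R E by fact
  show ?thesis
  proof (intro right_module.intro right_module_axioms.intro abelian_groupI)
    show "ring R" by (rule B.R.ring_axioms)
    show "\<exists>y\<in>carrier (rmod_prod B E). y \<oplus>\<^bsub>rmod_prod B E\<^esub> x = \<zero>\<^bsub>rmod_prod B E\<^esub>"
      if "x \<in> carrier (rmod_prod B E)" for x
      using that
      by (intro bexI[of _ "(\<ominus>\<^bsub>B\<^esub> fst x, \<ominus>\<^bsub>E\<^esub> snd x)"]) (auto simp: B.M.l_neg E.M.l_neg)
  qed (auto simp: B.M.a_ac E.M.a_ac B.rsmult_l_distr E.rsmult_l_distr B.rsmult_r_distr
         E.rsmult_r_distr B.rsmult_assoc E.rsmult_assoc)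
qed

text \<open>The graph is a module in its own right. By \<open>sv\<close> the first projection embeds
  it into \<open>B\<close>, and injectivity of \<open>E\<close> extends the second projection along
  this embedding.\<close>

lemma graph_extend:
  assumes inj: "injective_rmod R E" and B: "right_module R B"
    and G: "right_submodule G R (rmod_prod B E)" and sv: "\<And>y. (\<zero>\<^bsub>B\<^esub>, y) \<in> G \<Longrightarrow> y = \<zero>\<^bsub>E\<^esub>"
  shows "\<exists>k\<in>rmod_hom R B E. \<forall>(b, y)\<in>G. k b = y"
proof -
  have E: "right_module R E" using inj by (simp add: injective_rmod_def)
  interpret P: right_module R "rmod_prod B E" by (rule right_module_rmod_prod[OF B E])
  note G' = P.submodD[OF G]
  let ?G = "rmod_prod B E\<lparr>carrier := G\<rparr>"
  have mod: "right_module R ?G" by (rule P.submod_right_module[OF G])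
  have "fst \<in> rmod_hom R (rmod_prod B E) B" "snd \<in> rmod_hom R (rmod_prod B E) E"
    by (auto intro!: rmod_homI)
  then have hom: "fst \<in> rmod_hom R ?G B" "snd \<in> rmod_hom R ?G E"
    using rmod_hom_restrict G'(2) by blast+
  have "inj_on fst G"
    using rmod_hom_inj_onI[OF mod B hom(1), of G] sv
      right_module.submod_carrier[OF mod] by force
  then have "fst \<in> rmod_mon R ?G B" using hom by (simp add: rmod_mon_def)
  then obtain k where "k \<in> rmod_hom R B E" "\<forall>a\<in>G. k (fst a) = snd a"
    using injective_rmod_extend[OF inj mod B _ hom(2)] by auto
  then show ?thesis by (force intro: bexI[of _ k])
qed

section \<open>Injective modules: gluing, isomorphisms and direct summands\<close>

locale injective_module = right_module R E
  for R :: "('r, 'x) ring_scheme" and E :: "('r, 'e) right_module" (structure) +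
  assumes injective: "injective_rmod R E"
begin

lemma right_module_E: "right_module R E"
  using injective by (simp add: injective_rmod_def)

text \<open>The inclusion of \<open>K\<close> into \<open>E\<close> is extended along the embedding
  \<open>t\<close>.\<close>

lemma left_inverse:
  assumes "right_module R B" "submod K" "t \<in> rmod_hom R (E\<lparr>carrier := K\<rparr>) B" "inj_on t K"
  obtains r where "r \<in> rmod_hom R B E" "\<And>x. x \<in> K \<Longrightarrow> r (t x) = x"
proof -
  have "(\<lambda>x. x) \<in> rmod_hom R (E\<lparr>carrier := K\<rparr>) E"
    using rmod_hom_id submod_subset[OF assms(2)] by (rule rmod_hom_restrict)
  moreover have "t \<in> rmod_mon R (E\<lparr>carrier := K\<rparr>) B"
    using assms by (simp add: rmod_mon_def)
  ultimately show thesis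
    using injective_rmod_extend[OF injective submod_right_module[OF assms(2)] assms(1)] that by fastforce
qed

text \<open>The sum of the graphs of \<open>s\<close> and \<open>t\<close> is again single-valued
  because \<open>K\<close> and \<open>L\<close> are independent, so \<open>graph_extend\<close>
  applies.\<close>

lemma glue:
  assumes B: "right_module R B"
    and K: "right_submodule K R B" and L: "right_submodule L R B" and KL: "K \<inter> L \<subseteq> {\<zero>\<^bsub>B\<^esub>}"
    and s: "s \<in> rmod_hom R (B\<lparr>carrier := K\<rparr>) E" and t: "t \<in> rmod_hom R (B\<lparr>carrier := L\<rparr>) E"
  obtains k where "k \<in> rmod_hom R B E" "\<And>x. x \<in> K \<Longrightarrow> k x = s x" "\<And>x. x \<in> L \<Longrightarrow> k x = t x"
proof -
  interpret B: right_module R B by fact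
  interpret P: right_module R "rmod_prod B E" by (rule right_module_rmod_prod[OF B right_module_E])
  note s' = rmod_homD[OF s, simplified] and t' = rmod_homD[OF t, simplified]
  have s0: "s \<zero>\<^bsub>B\<^esub> = \<zero>"
    using rmod_hom_zero[OF B.submod_right_module[OF K] right_module_E s] by simp
  have t0: "t \<zero>\<^bsub>B\<^esub> = \<zero>"
    using rmod_hom_zero[OF B.submod_right_module[OF L] right_module_E t] by simp
  note K' = B.submodD[OF K] and L' = B.submodD[OF L]
  define Gs where "Gs = (\<lambda>x. (x, s x)) ` K"
  define Gt where "Gt = (\<lambda>x. (x, t x)) ` L"
  have Gs: "P.submod Gs"
    using K' s' s0 unfolding Gs_def by (intro P.submodI) auto
  have Gt: "P.submod Gt"
    using L' t' t0 unfolding Gt_def by (intro P.submodI) auto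
  define G where "G = Gs <+>\<^bsub>rmod_prod B E\<^esub> Gt"
  have G: "P.submod G"
    unfolding G_def using Gs Gt by (rule P.submod_msum)
  have "y = \<zero>" if y: "(\<zero>\<^bsub>B\<^esub>, y) \<in> G" for y
  proof -
    obtain x z where *: "x \<in> K" "z \<in> L" "x \<oplus>\<^bsub>B\<^esub> z = \<zero>\<^bsub>B\<^esub>" "y = s x \<oplus> t z"
      using y unfolding G_def P.msum_iff Gs_def Gt_def by auto
    then have "x = \<zero>\<^bsub>B\<^esub>" "z = \<zero>\<^bsub>B\<^esub>"
      using B.direct_zero[OF K L KL] by auto
    then show ?thesis using * s0 t0 by simp
  qed
  then obtain k where k: "k \<in> rmod_hom R B E" "\<forall>(b, y)\<in>G. k b = y"
    using graph_extend[OF injective B G] by blast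
  have "Gs \<subseteq> G" "Gt \<subseteq> G"
    unfolding G_def using P.msum_left[OF Gs Gt] P.msum_right[OF Gs Gt] by auto
  then show thesis
    using k by (intro that[of k]) (auto simp: Gs_def Gt_def)
qed

lemma glue_endo:
  assumes "submod K" "submod L" "K \<inter> L \<subseteq> {\<zero>}" "s \<in> rmod_hom R E E" "t \<in> rmod_hom R E E"
  obtains k where "k \<in> rmod_hom R E E" "\<And>x. x \<in> K \<Longrightarrow> k x = s x" "\<And>x. x \<in> L \<Longrightarrow> k x = t x"
  using glue[OF right_module_E assms(1-3) rmod_hom_restrict rmod_hom_restrict]
    submod_subset assms by blast

text \<open>The kernel of \<open>a\<close> misses the essential \<open>D\<close>, hence is zero, and
  injectivity of \<open>E\<close> gives \<open>b\<close> with \<open>b a = 1\<close>. The kernel of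
  \<open>b\<close> in turn misses the essential image of \<open>D\<close>, so \<open>b\<close> is
  injective, and \<open>a b = 1\<close> follows from \<open>b a b = b\<close>.\<close>

lemma isoI:
  assumes E': "right_module R E'" and a: "a \<in> rmod_hom R E E'" and D: "submod D" "ess D (carrier E)"
    and inj: "inj_on a D" and ess': "right_module.ess R E' (a ` D) (carrier E')"
  shows "a \<in> rmod_iso R E E'"
proof -
  interpret E': right_module R E' by fact
  note a' = rmod_homD[OF a]
  have a0: "a \<zero> = \<zero>\<^bsub>E'\<^esub>" by (rule rmod_hom_zero[OF right_module_E E' a])
  have "inj_on a (carrier E)"
  proof (rule rmod_hom_inj_onI[OF right_module_E E' a submod_carrier], rule ccontr)
    fix x assume x: "x \<in> carrier E" "a x = \<zero>\<^bsub>E'\<^esub>" "x \<noteq> \<zero>"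
    then obtain r where r: "r \<in> carrier R" "x \<cdot> r \<in> D" "x \<cdot> r \<noteq> \<zero>"
      using D(2) unfolding ess_def by blast
    then have "a (x \<cdot> r) = \<zero>\<^bsub>E'\<^esub>" using x a'(3) by (simp add: E'.rsmult_zero_left)
    then show False
      using rmod_hom_inj_onD[OF right_module_E E' a D(1) inj] r by blast
  qed
  moreover have "a \<in> rmod_hom R (E\<lparr>carrier := carrier E\<rparr>) E'"
    using a by (rule rmod_hom_restrict) simp
  ultimately obtain b where b: "b \<in> rmod_hom R E' E" and ba: "\<And>x. x \<in> carrier E \<Longrightarrow> b (a x) = x"
    using left_inverse[OF E' submod_carrier] by blast
  note b' = rmod_homD[OF b]
  have "inj_on b (carrier E')"
  proof (rule rmod_hom_inj_onI[OF E' right_module_E b E'.submod_carrier], rule ccontr)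
    fix y assume y: "y \<in> carrier E'" "b y = \<zero>" "y \<noteq> \<zero>\<^bsub>E'\<^esub>"
    then obtain r where r: "r \<in> carrier R" "y \<cdot>\<^bsub>E'\<^esub> r \<in> a ` D" "y \<cdot>\<^bsub>E'\<^esub> r \<noteq> \<zero>\<^bsub>E'\<^esub>"
      using ess' unfolding E'.ess_def by blast
    then obtain d where d: "d \<in> D" "y \<cdot>\<^bsub>E'\<^esub> r = a d" by blast
    have "b (y \<cdot>\<^bsub>E'\<^esub> r) = \<zero>" using y r b'(3) by (simp add: rsmult_zero_left)
    then have "d = \<zero>" using d ba submod_mem[OF D(1)] by simp
    then show False using d r a0 by simp
  qed
  then have "a (b y) = y" if "y \<in> carrier E'" for y
    using that ba a'(1) b'(1) by (auto dest: inj_onD)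
  then have "a ` carrier E = carrier E'"
    using a'(1) b'(1) by (force intro: rev_image_eqI)
  then show ?thesis
    using a \<open>inj_on a (carrier E)\<close> by (simp add: rmod_iso_def bij_betw_def)
qed

text \<open>The image of \<open>p\<close> plays the role of an injective hull of \<open>C\<close>,
  realised as a direct summand whose complement contains \<open>B\<close>. It arises from two
  maximal choices: \<open>W\<close> above \<open>B\<close> missing \<open>C\<close>, then
  \<open>D\<close> above \<open>C\<close> missing \<open>W\<close>; \<open>p\<close> extends the
  identity on \<open>D\<close> and zero on \<open>W\<close>.\<close>

lemma summand:
  assumes C: "submod C" and B: "submod B" and CB: "C \<inter> B \<subseteq> {\<zero>}"
  obtains p where "p \<in> rmod_hom R E E" "\<And>x. x \<in> carrier E \<Longrightarrow> p (p x) = p x"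
    and "\<And>x. x \<in> C \<Longrightarrow> p x = x" "\<And>x. x \<in> B \<Longrightarrow> p x = \<zero>" "ess C (p ` carrier E)"
proof -
  obtain W where W: "submod W" "B \<subseteq> W" "W \<subseteq> carrier E" "W \<inter> C = {\<zero>}"
    and Wmax: "\<And>X. \<lbrakk>submod X; W \<subseteq> X; X \<subseteq> carrier E; X \<inter> C \<subseteq> {\<zero>}\<rbrakk> \<Longrightarrow> X = W"
    using complement_exists[OF submod_carrier B submod_subset[OF B] C] CB by blast
  obtain D where D: "submod D" "C \<subseteq> D" "D \<subseteq> carrier E" "D \<inter> W = {\<zero>}"
    and Dmax: "\<And>X. \<lbrakk>submod X; D \<subseteq> X; X \<subseteq> carrier E; X \<inter> W \<subseteq> {\<zero>}\<rbrakk> \<Longrightarrow> X = D"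
    using complement_exists[OF submod_carrier C submod_subset[OF C] W(1)] W(4) by blast
  obtain p where p: "p \<in> rmod_hom R E E" "\<And>x. x \<in> D \<Longrightarrow> p x = x" "\<And>x. x \<in> W \<Longrightarrow> p x = \<zero>"
    using glue_endo[OF D(1) W(1) _ rmod_hom_id rmod_hom_const_zero[OF right_module_E]] D(4) by blast
  \<comment> \<open>On \<open>C\<close> the map \<open>p\<close> is the identity, so this preimage
    still misses \<open>C\<close> and maximality of \<open>W\<close> applies. Therefore
    \<open>p x\<close> in \<open>W\<close> forces \<open>p x = \<zero>\<close>, the image of
    \<open>p\<close> misses \<open>W\<close>, and maximality of \<open>D\<close> gives
    \<open>im\<close>.\<close>
  have "{x \<in> carrier E. p x \<in> W} = W"
  proof (rule Wmax)
    show "submod {x \<in> carrier E. p x \<in> W}"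
      by (rule submod_vimage[OF right_module_E right_module_E p(1) submod_carrier W(1)])
    show "W \<subseteq> {x \<in> carrier E. p x \<in> W}"
      using W p(3) submod_zero by auto
    show "{x \<in> carrier E. p x \<in> W} \<inter> C \<subseteq> {\<zero>}"
      using p(2) D(2) W(4) by fastforce
  qed auto
  then have *: "p x = \<zero>" if "x \<in> carrier E" "p x \<in> W" for x
    using that p(3) by blast
  have im: "p ` carrier E = D"
  proof (rule Dmax)
    show "submod (p ` carrier E)"
      using submod_image[OF right_module_E right_module_E _ submod_carrier, of p] p(1) by simp
    show "D \<subseteq> p ` carrier E" using p(2) D(3) by force
    show "p ` carrier E \<subseteq> carrier E" using rmod_homD(1)[OF p(1)] by auto
    show "p ` carrier E \<inter> W \<subseteq> {\<zero>}" using * by auto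
  qed
  \<comment> \<open>A submodule of \<open>D\<close> missing \<open>C\<close> could be added to
    \<open>W\<close> without meeting \<open>C\<close>.\<close>
  have "ess C D"
  proof (rule essI[OF D(1) C])
    fix X assume X: "submod X" "X \<subseteq> D" "X \<inter> C \<subseteq> {\<zero>}"
    have "X <+>\<^bsub>E\<^esub> W = W"
    proof (rule Wmax)
      show "(X <+>\<^bsub>E\<^esub> W) \<inter> C \<subseteq> {\<zero>}"
      proof
        fix c assume "c \<in> (X <+>\<^bsub>E\<^esub> W) \<inter> C"
        then obtain x w where xw: "x \<in> X" "w \<in> W" "c \<in> C" "x \<oplus> w = c" by (auto simp: msum_iff)
        then have "x = c \<and> w = \<zero>"
          using X D submod_zero[OF W(1)] submod_mem[OF C]
          by (intro direct_unique[OF D(1) W(1)]) auto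
        then show "c \<in> {\<zero>}" using xw X(3) by auto
      qed
    qed (use X W submod_msum msum_right submod_subset in auto)
    then have "X \<subseteq> W" using msum_left[OF X(1) W(1)] by simp
    then show "X \<subseteq> {\<zero>}" using X D(4) by blast
  qed
  show thesis
  proof (rule that[OF p(1)])
    show "p (p x) = p x" if "x \<in> carrier E" for x
      using p(2)[of "p x"] im that by blast
    show "p x = x" if "x \<in> C" for x
      using p(2) D(2) that by blast
    show "p x = \<zero>" if "x \<in> B" for x
      using p(3) W(2) that by blast
    show "ess C (p ` carrier E)"
      unfolding im by fact
  qed
qed

text \<open>Zorn's lemma is applied to the graphs of the maps \<open>t\<close>, as submodules of \<open>E \<times> E\<close>.\<close>

lemma maximal_doubling:
  assumes P: "submod P" and Q: "submod Q"
  obtains C t where "submod C" "C \<subseteq> P" "t \<in> rmod_hom R E E" "inj_on t C" "t ` C \<subseteq> Q"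
    "C \<inter> t ` C = {\<zero>}"
    and "\<And>D s. \<lbrakk>submod D; D \<subseteq> P; s \<in> rmod_hom R E E; s ` D \<subseteq> Q; inj_on s D; C \<inter> D \<subseteq> {\<zero>};
       t ` C \<inter> s ` D \<subseteq> {\<zero>}; (C <+>\<^bsub>E\<^esub> D) \<inter> (t ` C <+>\<^bsub>E\<^esub> s ` D) \<subseteq> {\<zero>}\<rbrakk> \<Longrightarrow> D \<subseteq> {\<zero>}"
proof -
  interpret X: right_module R "rmod_prod E E"
    by (rule right_module_rmod_prod[OF right_module_E right_module_E])
  \<comment> \<open>Graphs of injective partial maps from \<open>P\<close> to \<open>Q\<close> whose
    domain and image meet trivially. The second condition is injectivity; the last one makes every
    element vanish that is both a value and an argument.\<close>
  define F where "F = {G. X.submod G \<and> (\<forall>y. (\<zero>, y) \<in> G \<longrightarrow> y = \<zero>) \<and> (\<forall>x. (x, \<zero>) \<in> G \<longrightarrow> x = \<zero>) \<and>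
    (\<forall>x y. (x, y) \<in> G \<longrightarrow> x \<in> P \<and> y \<in> Q) \<and> (\<forall>x y z. (x, y) \<in> G \<longrightarrow> (y, z) \<in> G \<longrightarrow> y = \<zero>)}"
  have "{\<zero>\<^bsub>rmod_prod E E\<^esub>} \<in> F"
    unfolding F_def using submod_zero[OF P] submod_zero[OF Q] X.submod_0 by auto
  moreover have "\<Union>\<C> \<in> F" if "\<C> \<noteq> {}" "subset.chain F \<C>" for \<C>
  proof -
    have *: "G \<in> F" if "G \<in> \<C>" for G
      using that \<open>subset.chain F \<C>\<close> by (auto simp: subset.chain_def)
    have "X.submod (\<Union>\<C>)"
      by (rule X.submod_Union_chain[OF that]) (use * in \<open>auto simp: F_def\<close>)
    moreover have "y = \<zero>" if xy: "(x, y) \<in> \<Union>\<C>" "(y, z) \<in> \<Union>\<C>" for x y z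
    proof -
      obtain G where "G \<in> \<C>" "(x, y) \<in> G" "(y, z) \<in> G"
        using xy \<open>subset.chain F \<C>\<close> unfolding subset_chain_def by blast
      then show ?thesis using * unfolding F_def by blast
    qed
    ultimately show ?thesis using * unfolding F_def by blast
  qed
  ultimately obtain G where "G \<in> F" and max: "\<And>X. X \<in> F \<Longrightarrow> G \<subseteq> X \<Longrightarrow> X = G"
    using subset_Zorn_nonempty[of F] by blast
  then have G: "X.submod G" "\<And>y. (\<zero>, y) \<in> G \<Longrightarrow> y = \<zero>" "\<And>x. (x, \<zero>) \<in> G \<Longrightarrow> x = \<zero>"
    "\<And>x y. (x, y) \<in> G \<Longrightarrow> x \<in> P \<and> y \<in> Q" "\<And>x y z. (x, y) \<in> G \<Longrightarrow> (y, z) \<in> G \<Longrightarrow> y = \<zero>"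
    unfolding F_def by blast+
  obtain t where t: "t \<in> rmod_hom R E E" and "\<forall>(x, y)\<in>G. t x = y"
    using graph_extend[OF injective right_module_E G(1,2)] by blast
  then have t_eq: "t x = y" if "(x, y) \<in> G" for x y
    using that by auto
  define C where "C = fst ` G"
  have "fst \<in> rmod_hom R (rmod_prod E E) E"
    by (auto intro!: rmod_homI)
  then have C: "submod C"
    unfolding C_def using submod_subset
    by (intro submod_image[OF X.right_module_axioms right_module_E rmod_hom_restrict G(1)] X.submod_subset G) auto
  have Gt: "(x, t x) \<in> G" if "x \<in> C" for x
    using that t_eq by (auto simp: C_def)
  have CI: "x \<in> C" if "(x, y) \<in> G" for x y
    using that by (force simp: C_def)
  have injt: "inj_on t C"
    by (rule rmod_hom_inj_onI[OF right_module_E right_module_E t C]) (use Gt G(3) in force)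
  have t0: "t \<zero> = \<zero>" by (rule rmod_hom_zero[OF right_module_E right_module_E t])
  have tC: "submod (t ` C)"
    by (rule submod_image[OF right_module_E right_module_E rmod_hom_restrict[OF t] C])
       (rule submod_subset[OF C])
  show thesis
  proof (rule that[OF C _ t injt])
    show "C \<subseteq> P" "t ` C \<subseteq> Q" using Gt G(4) by blast+
    show "C \<inter> t ` C = {\<zero>}"
    proof
      show "C \<inter> t ` C \<subseteq> {\<zero>}" using Gt G(5) by blast
      show "{\<zero>} \<subseteq> C \<inter> t ` C" using submod_zero[OF C] submod_zero[OF tC] by simp
    qed
  next
    fix D s assume D: "submod D" "D \<subseteq> P" and s: "s \<in> rmod_hom R E E" "s ` D \<subseteq> Q" "inj_on s D"
      and CD: "C \<inter> D \<subseteq> {\<zero>}" and ts: "t ` C \<inter> s ` D \<subseteq> {\<zero>}"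
      and all: "(C <+>\<^bsub>E\<^esub> D) \<inter> (t ` C <+>\<^bsub>E\<^esub> s ` D) \<subseteq> {\<zero>}"
    have s0: "s \<zero> = \<zero>" by (rule rmod_hom_zero[OF right_module_E right_module_E s(1)])
    have sD: "submod (s ` D)"
      by (rule submod_image[OF right_module_E right_module_E rmod_hom_restrict[OF s(1)] D(1)])
         (rule submod_subset[OF D(1)])
    \<comment> \<open>Adjoining the graph of \<open>s\<close> on \<open>D\<close> yields another
      member of \<open>F\<close>, so maximality forces \<open>S\<close> into \<open>G\<close> and
      \<open>D\<close> into \<open>C\<close>, while \<open>D\<close> misses
      \<open>C\<close>.\<close>
    define S where "S = (\<lambda>x. (x, s x)) ` D"
    have S: "X.submod S"
      using submodD[OF D(1)] rmod_homD[OF s(1)] s0 unfolding S_def by (intro X.submodI) auto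
    define G' where "G' = G <+>\<^bsub>rmod_prod E E\<^esub> S"
    have G': "X.submod G'" unfolding G'_def by (rule X.submod_msum[OF G(1) S])
    have elim: "\<exists>c\<in>C. \<exists>d\<in>D. x = c \<oplus> d \<and> y = t c \<oplus> s d" if xy: "(x, y) \<in> G'" for x y
    proof -
      obtain g d where "g \<in> G" "d \<in> D" "(x, y) = g \<oplus>\<^bsub>rmod_prod E E\<^esub> (d, s d)"
        using xy unfolding G'_def X.msum_iff S_def by auto
      then show ?thesis
        using CI[of "fst g" "snd g"] t_eq[of "fst g" "snd g"]
        by (intro bexI[of _ "fst g"] bexI[of _ d]) auto
    qed
    \<comment> \<open>The images of \<open>C\<close> and \<open>D\<close> are independent and both
      maps are injective, so the enlarged map is injective.\<close>
    have injz: "c = \<zero> \<and> d = \<zero>" if "c \<in> C" "d \<in> D" "t c \<oplus> s d = \<zero>" for c d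
    proof -
      have "t c = \<zero> \<and> s d = \<zero>"
        using that by (intro direct_zero[OF tC sD ts]) auto
      then show ?thesis
        using that rmod_hom_inj_onD[OF right_module_E right_module_E t C injt]
          rmod_hom_inj_onD[OF right_module_E right_module_E s(1) D(1) s(3)] by blast
    qed
    have "G' \<in> F"
      unfolding F_def
    proof (intro CollectI conjI allI impI)
      show "y = \<zero>" if xy: "(\<zero>, y) \<in> G'" for y
      proof -
        obtain c d where "c \<in> C" "d \<in> D" "c \<oplus> d = \<zero>" "y = t c \<oplus> s d" using elim[OF xy] by auto
        moreover from this have "c = \<zero> \<and> d = \<zero>" by (intro direct_zero[OF C D(1) CD]) auto
        ultimately show ?thesis using s0 t0 by simp
      qed
      show "x = \<zero>" if xy: "(x, \<zero>) \<in> G'" for x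
      proof -
        obtain c d where "c \<in> C" "d \<in> D" "x = c \<oplus> d" "t c \<oplus> s d = \<zero>" using elim[OF xy] by auto
        then show ?thesis using injz[of c d] by simp
      qed
      show "x \<in> P" "y \<in> Q" if xy: "(x, y) \<in> G'" for x y
      proof -
        obtain c d where *: "c \<in> C" "d \<in> D" "x = c \<oplus> d" "y = t c \<oplus> s d" using elim[OF xy] by auto
        then have "c \<in> P" "t c \<in> Q" using G(4)[OF Gt] by auto
        then show "x \<in> P" "y \<in> Q"
          using * D s(2) submod_add[OF P] submod_add[OF Q] by auto
      qed
      show "y = \<zero>" if xy: "(x, y) \<in> G'" "(y, z) \<in> G'" for x y z
      proof -
        obtain c d where "c \<in> C" "d \<in> D" "y = t c \<oplus> s d" using elim[OF xy(1)] by auto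
        then have "y \<in> t ` C <+>\<^bsub>E\<^esub> s ` D" by (auto intro: msumI)
        moreover obtain c d where "c \<in> C" "d \<in> D" "y = c \<oplus> d" using elim[OF xy(2)] by auto
        then have "y \<in> C <+>\<^bsub>E\<^esub> D" by (auto intro: msumI)
        ultimately show ?thesis using all by blast
      qed
    qed (rule G')
    moreover have "G \<subseteq> G'" "S \<subseteq> G'"
      unfolding G'_def using X.msum_left[OF G(1) S] X.msum_right[OF G(1) S] by auto
    ultimately have "S \<subseteq> G" using max by blast
    then have "D \<subseteq> C" using CI by (auto simp: S_def)
    then show "D \<subseteq> {\<zero>}" using CD by blast
  qed
qed

end

section \<open>Doubled submodules\<close>

context injective_module
begin

abbreviation End :: "('e \<Rightarrow> 'e) set" where
  "End \<equiv> rmod_hom R E E"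

lemmas End_zero = rmod_hom_zero[OF right_module_E right_module_E]
  and End_minus = rmod_hom_minus[OF right_module_E right_module_E]
  and End_inj_onI = rmod_hom_inj_onI[OF right_module_E right_module_E]
  and End_inj_onD = rmod_hom_inj_onD[OF right_module_E right_module_E]
  and End_vimage = submod_vimage[OF right_module_E right_module_E]
  and End_add = rmod_hom_add[OF right_module_E]
  and End_diff = rmod_hom_diff[OF right_module_E]
  and End_const_zero = rmod_hom_const_zero[OF right_module_E]

lemma End_image:
  assumes "h \<in> End" "submod K" shows "submod (h ` K)"
  by (rule submod_image[OF right_module_E right_module_E rmod_hom_restrict[OF assms(1)] assms(2)])
     (rule submod_subset[OF assms(2)])

lemma End_left_inverse:
  assumes "submod K" "t \<in> End" "inj_on t K"
  obtains r where "r \<in> End" "\<And>x. x \<in> K \<Longrightarrow> r (t x) = x"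
  using left_inverse[OF right_module_E assms(1) rmod_hom_restrict[OF assms(2)] assms(3)]
    submod_subset[OF assms(1)] by blast

text \<open>\<open>t\<close> is taken on all of \<open>E\<close>: as \<open>E\<close> is injective,
  every embedding of \<open>C\<close> into \<open>E\<close> extends.\<close>

definition doubled :: "'e set \<Rightarrow> bool" where
  "doubled C \<longleftrightarrow> submod C \<and> (\<exists>t\<in>End. inj_on t C \<and> C \<inter> t ` C \<subseteq> {\<zero>})"

text \<open>Extend \<open>f\<close> by the identity on a complement \<open>V\<close> of
  \<open>B\<close>. A failure of injectivity on \<open>B + V\<close>, or of essentiality of the
  image, would produce a nonzero doubled submodule of \<open>B\<close>; hence \<open>isoI\<close>
  applies.\<close>

lemma iso_extend_if_not_doubled:
  assumes B: "submod B" and f: "f \<in> End" "inj_on f B"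
    and nd: "\<And>D. \<lbrakk>doubled D; D \<subseteq> B\<rbrakk> \<Longrightarrow> D \<subseteq> {\<zero>}"
  obtains a where "a \<in> rmod_iso R E E" "\<And>x. x \<in> B \<Longrightarrow> a x = f x"
proof -
  have fB: "submod (f ` B)" by (rule End_image[OF f(1) B])
  obtain V where V: "submod V" "V \<subseteq> carrier E" "V \<inter> B = {\<zero>}"
    and ess: "ess (B <+>\<^bsub>E\<^esub> V) (carrier E)"
    using ess_complement_exists[OF submod_carrier B submod_subset[OF B]] by blast
  have BV: "B \<inter> V \<subseteq> {\<zero>}" using V(3) by blast
  have BVs: "submod (B <+>\<^bsub>E\<^esub> V)" using B V by (intro submod_msum)
  have fBV: "f ` B \<inter> V \<subseteq> {\<zero>}"
  proof
    fix y assume "y \<in> f ` B \<inter> V"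
    then obtain b where b: "b \<in> B" "y = f b" "f b \<in> V" by blast
    \<comment> \<open>\<open>f\<close> sends \<open>D\<close> into \<open>V\<close>, which misses
      \<open>B\<close>, so \<open>f\<close> itself doubles \<open>D\<close>.\<close>
    define D where "D = {x \<in> B. f x \<in> V}"
    have "submod D" unfolding D_def by (rule End_vimage[OF f(1) B V(1)])
    moreover have "inj_on f D" using f(2) by (rule inj_on_subset) (auto simp: D_def)
    moreover have "D \<inter> f ` D \<subseteq> {\<zero>}" using V(3) by (auto simp: D_def)
    ultimately have "D \<subseteq> {\<zero>}" using f(1) by (intro nd) (auto simp: doubled_def D_def)
    then have "b = \<zero>" using b by (auto simp: D_def)
    then show "y \<in> {\<zero>}" using b End_zero[OF f(1)] by simp
  qed
  obtain a where a: "a \<in> End" "\<And>x. x \<in> B \<Longrightarrow> a x = f x" "\<And>x. x \<in> V \<Longrightarrow> a x = x"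
    using glue_endo[OF B V(1) BV f(1) rmod_hom_id] by blast
  have a_sum: "a (b \<oplus> v) = f b \<oplus> v" if "b \<in> B" "v \<in> V" for b v
    using that a rmod_homD(2)[OF a(1)] submod_mem[OF B] submod_mem[OF V(1)] by simp
  have img: "a ` (B <+>\<^bsub>E\<^esub> V) = f ` B <+>\<^bsub>E\<^esub> V"
  proof
    show "a ` (B <+>\<^bsub>E\<^esub> V) \<subseteq> f ` B <+>\<^bsub>E\<^esub> V" using a_sum by (fastforce simp: msum_iff)
    show "f ` B <+>\<^bsub>E\<^esub> V \<subseteq> a ` (B <+>\<^bsub>E\<^esub> V)"
    proof
      fix y assume "y \<in> f ` B <+>\<^bsub>E\<^esub> V"
      then obtain b v where "b \<in> B" "v \<in> V" "y = f b \<oplus> v" by (auto simp: msum_iff)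
      then show "y \<in> a ` (B <+>\<^bsub>E\<^esub> V)"
        using a_sum by (intro image_eqI[of _ _ "b \<oplus> v"]) (auto intro: msumI)
    qed
  qed
  have inj: "inj_on a (B <+>\<^bsub>E\<^esub> V)"
  proof (rule End_inj_onI[OF a(1) BVs])
    fix x assume "x \<in> B <+>\<^bsub>E\<^esub> V" "a x = \<zero>"
    then obtain b v where *: "b \<in> B" "v \<in> V" "x = b \<oplus> v" "f b \<oplus> v = \<zero>"
      using a_sum by (auto simp: msum_iff)
    then have "f b = \<zero> \<and> v = \<zero>" by (intro direct_zero[OF fB V(1) fBV]) auto
    then show "x = \<zero>" using * End_inj_onD[OF f(1) B f(2), of b] by simp
  qed
  have fBVs: "submod (f ` B <+>\<^bsub>E\<^esub> V)" using fB V by (intro submod_msum)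
  have "ess (f ` B <+>\<^bsub>E\<^esub> V) (carrier E)"
  proof (rule essI[OF submod_carrier fBVs])
    fix W assume W: "submod W" "W \<subseteq> carrier E" "W \<inter> (f ` B <+>\<^bsub>E\<^esub> V) \<subseteq> {\<zero>}"
    \<comment> \<open>\<open>W'\<close> meets \<open>V\<close> trivially, so its projection
      \<open>C\<close> to \<open>B\<close> is a copy of it, with \<open>r\<close> as the inverse
      embedding. Two doublings then kill \<open>C\<close>: \<open>r\<close> doubles
      \<open>K\<close>, because \<open>r K\<close> lies in \<open>W\<close> and \<open>K\<close> in
      \<open>f B\<close>; so \<open>K\<close> is zero, \<open>C\<close> misses \<open>f C\<close>,
      and \<open>f\<close> doubles \<open>C\<close>.\<close>
    define W' where "W' = W \<inter> (B <+>\<^bsub>E\<^esub> V)"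
    have W': "submod W'" unfolding W'_def by (intro submod_Int W BVs)
    have WV: "W \<inter> V \<subseteq> {\<zero>}" and WfB: "W \<inter> f ` B \<subseteq> {\<zero>}"
      using W(3) msum_left[OF fB V(1)] msum_right[OF fB V(1)] by blast+
    obtain p where p: "p \<in> End" "\<And>x. x \<in> B \<Longrightarrow> p x = x" "\<And>x. x \<in> V \<Longrightarrow> p x = \<zero>"
      using glue_endo[OF B V(1) BV rmod_hom_id End_const_zero] by blast
    have p_sum: "p (b \<oplus> v) = b" if "b \<in> B" "v \<in> V" for b v
      using that p rmod_homD(2)[OF p(1)] submod_mem[OF B] submod_mem[OF V(1)] by simp
    have pinj: "inj_on p W'"
    proof (rule End_inj_onI[OF p(1) W'])
      fix x assume x: "x \<in> W'" "p x = \<zero>"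
      then obtain b v where *: "b \<in> B" "v \<in> V" "x = b \<oplus> v" by (auto simp: W'_def msum_iff)
      then have "x \<in> V" using x p_sum submod_mem[OF V(1)] by simp
      then show "x = \<zero>" using x WV by (auto simp: W'_def)
    qed
    define C where "C = p ` W'"
    have C: "submod C" unfolding C_def by (rule End_image[OF p(1) W'])
    have CB: "C \<subseteq> B" using p_sum by (auto simp: C_def W'_def msum_iff)
    obtain r where r: "r \<in> End" "\<And>x. x \<in> W' \<Longrightarrow> r (p x) = x"
      using End_left_inverse[OF W' p(1) pinj] by blast
    have rW: "r x \<in> W" if "x \<in> C" for x using that r(2) by (auto simp: C_def W'_def)
    have r_inj: "inj_on r C" using r(2) by (auto simp: C_def intro!: inj_onI)
    define K where "K = C \<inter> f ` C"
    have K: "submod K" unfolding K_def by (intro submod_Int C End_image[OF f(1) C])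
    have "K \<inter> r ` K \<subseteq> {\<zero>}"
    proof
      fix y assume "y \<in> K \<inter> r ` K"
      then have "y \<in> f ` C" "y \<in> r ` C" by (auto simp: K_def)
      then have "y \<in> W" "y \<in> f ` B" using rW CB by auto
      then show "y \<in> {\<zero>}" using WfB by blast
    qed
    moreover have "inj_on r K" using r_inj by (rule inj_on_subset) (auto simp: K_def)
    ultimately have "K \<subseteq> {\<zero>}"
      using r(1) K CB by (intro nd) (auto simp: doubled_def K_def)
    then have "C \<subseteq> {\<zero>}"
      using f C CB inj_on_subset[OF f(2) CB] by (intro nd) (auto simp: doubled_def K_def)
    then have "W' \<subseteq> {\<zero>}"
      using End_inj_onD[OF p(1) W' pinj] by (auto simp: C_def)
    then show "W \<subseteq> {\<zero>}"
      using essD[OF ess W(1,2)] by (simp add: W'_def)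
  qed
  then have "a \<in> rmod_iso R E E"
    by (intro isoI[OF right_module_E a(1) BVs ess inj]) (simp add: img)
  then show thesis using a(2) that by blast
qed

text \<open>The module-theoretic analogue of splitting the domain of an injective partial map of a set
  into three pieces disjoint from their images and a remainder. Here \<open>(C1, t)\<close> is a maximal
  doubling inside \<open>A\<close> and \<open>Z = C1 + t C1\<close>; the piece \<open>C2\<close> exhausts \<open>A \<inter> Z\<close>, and \<open>C3\<close> is a maximal
  submodule independent of \<open>Z\<close> that embeds into \<open>C1\<close>.\<close>

lemma doubled_decomposition:
  assumes A: "submod A"
  obtains C1 C2 C3 B where "doubled C1" "doubled C2" "doubled C3" "submod B"
    and "C1 <+>\<^bsub>E\<^esub> C2 <+>\<^bsub>E\<^esub> (C3 <+>\<^bsub>E\<^esub> B) \<subseteq> A" "ess (C1 <+>\<^bsub>E\<^esub> C2 <+>\<^bsub>E\<^esub> (C3 <+>\<^bsub>E\<^esub> B)) A"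
    and "C1 \<inter> C2 \<subseteq> {\<zero>}" "C3 \<inter> B \<subseteq> {\<zero>}" "(C1 <+>\<^bsub>E\<^esub> C2) \<inter> (C3 <+>\<^bsub>E\<^esub> B) \<subseteq> {\<zero>}"
    and "\<And>D. \<lbrakk>doubled D; D \<subseteq> B\<rbrakk> \<Longrightarrow> D \<subseteq> {\<zero>}"
proof -
  \<comment> \<open>The target is all of \<open>E\<close>, so the copy \<open>t C\<close> may leave
    \<open>A\<close>.\<close>
  obtain C t where C: "submod C" "C \<subseteq> A" and t: "t \<in> End" "inj_on t C" "C \<inter> t ` C = {\<zero>}"
    and Cmax: "\<And>D s. \<lbrakk>submod D; D \<subseteq> A; s \<in> End; s ` D \<subseteq> carrier E; inj_on s D; C \<inter> D \<subseteq> {\<zero>};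
       t ` C \<inter> s ` D \<subseteq> {\<zero>}; (C <+>\<^bsub>E\<^esub> D) \<inter> (t ` C <+>\<^bsub>E\<^esub> s ` D) \<subseteq> {\<zero>}\<rbrakk> \<Longrightarrow> D \<subseteq> {\<zero>}"
    using maximal_doubling[OF A submod_carrier] by metis
  have tC: "submod (t ` C)" by (rule End_image[OF t(1) C(1)])
  have CtC: "C \<inter> t ` C \<subseteq> {\<zero>}" "t ` C \<inter> C \<subseteq> {\<zero>}" using t(3) by auto
  define Z where "Z = C <+>\<^bsub>E\<^esub> t ` C"
  have Z: "submod Z" unfolding Z_def by (intro submod_msum C tC)
  have CZ: "C \<subseteq> Z" and tCZ: "t ` C \<subseteq> Z"
    unfolding Z_def using msum_left[OF C(1) tC] msum_right[OF C(1) tC] by auto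
  have AZ: "submod (A \<inter> Z)" by (intro submod_Int A Z)
  \<comment> \<open>Coordinates on \<open>Z\<close>: every element is some
    \<open>c \<oplus> t d\<close>, where \<open>p\<close> returns \<open>c\<close> and
    \<open>p'\<close> returns \<open>d\<close>; \<open>r\<close> carries the second summand back
    into \<open>C\<close>.\<close>
  obtain r where r: "r \<in> End" "\<And>x. x \<in> C \<Longrightarrow> r (t x) = x"
    using End_left_inverse[OF C(1) t(1,2)] by blast
  obtain p where p: "p \<in> End" "\<And>x. x \<in> C \<Longrightarrow> p x = x" "\<And>x. x \<in> t ` C \<Longrightarrow> p x = \<zero>"
    using glue_endo[OF C(1) tC CtC(1) rmod_hom_id End_const_zero] by blast
  obtain p' where p': "p' \<in> End" "\<And>x. x \<in> C \<Longrightarrow> p' x = \<zero>" "\<And>x. x \<in> t ` C \<Longrightarrow> p' x = r x"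
    using glue_endo[OF C(1) tC CtC(1) End_const_zero r(1)] by blast
  have mem: "x \<in> carrier E" "t x \<in> carrier E" if "x \<in> C" for x
    using that submod_mem[OF C(1)] submod_mem[OF tC] by auto
  have p_sum: "p (c \<oplus> t d) = c" if "c \<in> C" "d \<in> C" for c d
    using that p rmod_homD(2)[OF p(1)] mem by simp
  have p'_sum: "p' (c \<oplus> t d) = d" if "c \<in> C" "d \<in> C" for c d
    using that p' r rmod_homD(2)[OF p'(1)] mem by simp
  have ZE: "\<exists>c\<in>C. \<exists>d\<in>C. z = c \<oplus> t d" if "z \<in> Z" for z
    using that by (auto simp: Z_def msum_iff)
  have p'Z: "p' z \<in> C" "p' z = \<zero> \<Longrightarrow> z \<in> C" if "z \<in> Z" for z
    using ZE[OF that] p'_sum End_zero[OF t(1)] mem by auto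
  have pZ: "p z \<in> C" "p z = \<zero> \<Longrightarrow> z \<in> t ` C" if "z \<in> Z" for z
    using ZE[OF that] p_sum mem by auto

  \<comment> \<open>On \<open>Z\<close> the kernel of \<open>p'\<close> is contained in
    \<open>C\<close>, so \<open>p'\<close> embeds a complement of \<open>C\<close> in
    \<open>A \<inter> Z\<close> into \<open>C\<close> and thereby doubles it.\<close>
  obtain C2 where C2: "submod C2" "C2 \<subseteq> A \<inter> Z" "C2 \<inter> C = {\<zero>}"
    and ess2: "ess (C <+>\<^bsub>E\<^esub> C2) (A \<inter> Z)"
    using ess_complement_exists[OF AZ C(1)] C(2) CZ by blast
  have dC2: "doubled C2"
  proof -
    have "inj_on p' C2"
      by (rule End_inj_onI[OF p'(1) C2(1)]) (use C2 p'Z in blast)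
    moreover have "C2 \<inter> p' ` C2 \<subseteq> {\<zero>}" using C2 p'Z(1) by blast
    ultimately show ?thesis using C2(1) p'(1) by (auto simp: doubled_def)
  qed
  have dC: "doubled C" using C(1) t by (auto simp: doubled_def)

  obtain B0 where B0: "submod B0" "B0 \<subseteq> A" "B0 \<inter> (A \<inter> Z) = {\<zero>}"
    and ess0: "ess (A \<inter> Z <+>\<^bsub>E\<^esub> B0) A"
    using ess_complement_exists[OF A AZ] by blast
  \<comment> \<open>\<open>B0\<close> lies in \<open>A\<close>, so missing
    \<open>A \<inter> Z\<close> amounts to missing \<open>Z\<close>.\<close>
  have B0Z: "B0 \<inter> Z \<subseteq> {\<zero>}" using B0 by blast

  \<comment> \<open>The domain lies in \<open>B0\<close> and the image in \<open>C\<close>, which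
    are independent already. The point is maximality: it will rule out embeddings of submodules of
    the complement \<open>B\<close> into the part of \<open>C\<close> independent of
    \<open>\<rho> C3\<close>.\<close>
  obtain C3 \<rho> where C3: "submod C3" "C3 \<subseteq> B0" and \<rho>: "\<rho> \<in> End" "inj_on \<rho> C3" "\<rho> ` C3 \<subseteq> C"
    and C3max: "\<And>D s. \<lbrakk>submod D; D \<subseteq> B0; s \<in> End; s ` D \<subseteq> C; inj_on s D; C3 \<inter> D \<subseteq> {\<zero>};
       \<rho> ` C3 \<inter> s ` D \<subseteq> {\<zero>}; (C3 <+>\<^bsub>E\<^esub> D) \<inter> (\<rho> ` C3 <+>\<^bsub>E\<^esub> s ` D) \<subseteq> {\<zero>}\<rbrakk> \<Longrightarrow> D \<subseteq> {\<zero>}"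
    using maximal_doubling[OF B0(1) C(1)] by metis
  have dC3: "doubled C3"
    using C3 \<rho> B0Z CZ unfolding doubled_def by blast
  have \<rho>C3: "submod (\<rho> ` C3)" by (rule End_image[OF \<rho>(1) C3(1)])

  obtain B where B: "submod B" "B \<subseteq> B0" "B \<inter> C3 = {\<zero>}"
    and ess3: "ess (C3 <+>\<^bsub>E\<^esub> B) B0"
    using ess_complement_exists[OF B0(1) C3] by blast

  have sub2: "C <+>\<^bsub>E\<^esub> C2 \<subseteq> A \<inter> Z" using C C2 CZ by (intro msum_least AZ) auto
  have sub3: "C3 <+>\<^bsub>E\<^esub> B \<subseteq> B0" using C3 B by (intro msum_least B0)
  have nd: "D \<subseteq> {\<zero>}" if D: "doubled D" "D \<subseteq> B" for D
  proof -
    \<comment> \<open>Embeddings into \<open>C\<close> are excluded in two stages. Where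
      \<open>s\<close> lands in \<open>\<rho> C3\<close>, following it by the inverse of
      \<open>\<rho>\<close> gives an embedding \<open>m\<close> into \<open>C3\<close>, which is
      independent of \<open>B\<close> and of \<open>Z\<close>; so \<open>(K', m)\<close> would
      enlarge \<open>(C, t)\<close>. Once \<open>K'\<close> is zero, \<open>s K\<close> misses
      \<open>\<rho> C3\<close> and \<open>(K, s)\<close> would enlarge
      \<open>(C3, \<rho>)\<close>.\<close>
    have noemb: "K \<subseteq> {\<zero>}" if K: "submod K" "K \<subseteq> D" and s: "s \<in> End" "inj_on s K" "s ` K \<subseteq> C" for K s
    proof -
      note sK = End_image[OF s(1) K(1)]
      obtain l where l: "l \<in> End" "\<And>x. x \<in> C3 \<Longrightarrow> l (\<rho> x) = x"
        using End_left_inverse[OF C3(1) \<rho>(1,2)] by blast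
      define K' where "K' = {x \<in> K. s x \<in> \<rho> ` C3}"
      have K': "submod K'" unfolding K'_def by (rule End_vimage[OF s(1) K(1) \<rho>C3])
      define m where "m x = l (s x)" for x
      have m: "m \<in> End" unfolding m_def by (rule rmod_hom_compose[OF s(1) l(1)])
      have mC3: "m x \<in> C3" "\<rho> (m x) = s x" if "x \<in> K'" for x
        using that l(2) by (auto simp: K'_def m_def)
      have minj: "inj_on m K'"
        using mC3(2) s(2) by (intro inj_onI) (metis (lifting) K'_def inj_onD mem_Collect_eq)
      have mK: "submod (m ` K')" by (rule End_image[OF m K'])
      have mZ: "m x = \<zero>" if "x \<in> K'" "m x \<in> Z" for x
        using mC3(1)[OF that(1)] that(2) C3(2) B0Z by blast
      have "K' \<subseteq> {\<zero>}"
      proof (rule Cmax[OF K' _ m _ minj])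
        show "K' \<subseteq> A" unfolding K'_def using K(2) D(2) B(2) B0(2) by blast
        show "m ` K' \<subseteq> carrier E" by (rule submod_subset[OF mK])
        show "C \<inter> K' \<subseteq> {\<zero>}" unfolding K'_def using K(2) D(2) B(2) B0Z CZ by blast
        show "t ` C \<inter> m ` K' \<subseteq> {\<zero>}" using mZ tCZ by auto
        show "(C <+>\<^bsub>E\<^esub> K') \<inter> (t ` C <+>\<^bsub>E\<^esub> m ` K') \<subseteq> {\<zero>}"
        proof
          fix x assume "x \<in> (C <+>\<^bsub>E\<^esub> K') \<inter> (t ` C <+>\<^bsub>E\<^esub> m ` K')"
          then obtain c d c' d' where *: "c \<in> C" "d \<in> K'" "c' \<in> C" "d' \<in> K'"
            "x = c \<oplus> d" "c \<oplus> d = t c' \<oplus> m d'" by (auto simp: msum_iff)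
          have d: "d \<in> B0" "d \<in> B" using *(2) K(2) D(2) B(2) unfolding K'_def by blast+
          have md: "m d' \<in> B0" "m d' \<in> C3" using mC3(1)[OF *(4)] C3 by auto
          have "c = t c' \<and> d = m d'"
            using * d md CZ tCZ B0Z by (intro direct_unique[OF Z B0(1)]) auto
          then have "c = \<zero>" "d = \<zero>" using * CtC d md B(3) by auto
          then show "x \<in> {\<zero>}" using * by simp
        qed
      qed
      then have s_zero: "s x = \<zero>" if "x \<in> K" "s x \<in> \<rho> ` C3" for x
        using that End_zero[OF s(1)] by (auto simp: K'_def)
      have disj: "\<rho> ` C3 \<inter> s ` K \<subseteq> {\<zero>}"
      proof
        fix y assume y: "y \<in> \<rho> ` C3 \<inter> s ` K"
        then obtain x where x: "x \<in> K" "y = s x" by blast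
        then show "y \<in> {\<zero>}" using s_zero[OF x(1)] y by simp
      qed
      show ?thesis
      proof (rule C3max[OF K(1) _ s(1,3,2) _ disj])
        show "K \<subseteq> B0" "C3 \<inter> K \<subseteq> {\<zero>}" using K(2) D(2) B(2,3) by blast+
        have "C3 <+>\<^bsub>E\<^esub> K \<subseteq> B0"
          by (intro msum_least B0 C3) (use K(2) D(2) B(2) in blast)
        moreover have "\<rho> ` C3 <+>\<^bsub>E\<^esub> s ` K \<subseteq> C" using s \<rho> by (intro msum_least C) auto
        ultimately show "(C3 <+>\<^bsub>E\<^esub> K) \<inter> (\<rho> ` C3 <+>\<^bsub>E\<^esub> s ` K) \<subseteq> {\<zero>}" using CZ B0Z by blast
      qed
    qed
    obtain \<tau> where Ds: "submod D" and \<tau>: "\<tau> \<in> End" "inj_on \<tau> D" "D \<inter> \<tau> ` D \<subseteq> {\<zero>}"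
      using D(1) by (auto simp: doubled_def)
    have DB0: "D \<subseteq> B0" using D B by auto
    have DZ: "D \<inter> Z \<subseteq> {\<zero>}" "Z \<inter> D \<subseteq> {\<zero>}" using DB0 B0Z by auto
    have ZD: "submod (Z <+>\<^bsub>E\<^esub> D)" by (intro submod_msum Z Ds)
    \<comment> \<open>On \<open>D1\<close> the map \<open>\<kappa>\<close> is the
      \<open>Z\<close>-component of \<open>\<tau>\<close>; its kernel is zero because
      \<open>\<tau> D\<close> misses \<open>D\<close>. The part \<open>D2\<close> sent into
      \<open>t C\<close> embeds into \<open>C\<close> through \<open>r\<close>, hence is zero. Then
      \<open>p\<close>, whose kernel on \<open>Z\<close> lies in \<open>t C\<close>, embeds the
      image of \<open>D1\<close> into \<open>C\<close>, so \<open>D1\<close> is zero as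
      well.\<close>
    define D1 where "D1 = {x \<in> D. \<tau> x \<in> Z <+>\<^bsub>E\<^esub> D}"
    have D1: "submod D1" unfolding D1_def by (rule End_vimage[OF \<tau>(1) Ds ZD])
    obtain q where q: "q \<in> End" "\<And>x. x \<in> Z \<Longrightarrow> q x = x" "\<And>x. x \<in> D \<Longrightarrow> q x = \<zero>"
      using glue_endo[OF Z Ds DZ(2) rmod_hom_id End_const_zero] by blast
    define \<kappa> where "\<kappa> x = q (\<tau> x)" for x
    have \<kappa>: "\<kappa> \<in> End" unfolding \<kappa>_def by (rule rmod_hom_compose[OF \<tau>(1) q(1)])
    have \<kappa>Z: "\<kappa> x \<in> Z \<and> (\<kappa> x = \<zero> \<longrightarrow> x = \<zero>)" if x: "x \<in> D1" for x
    proof -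
      obtain z d where zd: "z \<in> Z" "d \<in> D" "\<tau> x = z \<oplus> d"
        using x by (auto simp: D1_def msum_iff)
      have "\<kappa> x = z"
        using zd q rmod_homD(2)[OF q(1)] submod_mem[OF Z] submod_mem[OF Ds] by (simp add: \<kappa>_def)
      moreover have "x = \<zero>" if "z = \<zero>"
      proof -
        have "\<tau> x \<in> D" using zd that submod_mem[OF Ds] by simp
        then have "\<tau> x = \<zero>" using x \<tau>(3) by (auto simp: D1_def)
        then show ?thesis using x End_inj_onD[OF \<tau>(1) Ds \<tau>(2)] by (auto simp: D1_def)
      qed
      ultimately show ?thesis using zd by simp
    qed
    define D2 where "D2 = {x \<in> D1. \<kappa> x \<in> t ` C}"
    have D2: "submod D2" unfolding D2_def by (rule End_vimage[OF \<kappa> D1 tC])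
    have "D2 \<subseteq> {\<zero>}"
    proof (rule noemb[OF D2])
      show "D2 \<subseteq> D" by (auto simp: D2_def D1_def)
      show k: "(\<lambda>x. r (\<kappa> x)) \<in> End" by (rule rmod_hom_compose[OF \<kappa> r(1)])
      show "inj_on (\<lambda>x. r (\<kappa> x)) D2"
      proof (rule End_inj_onI[OF k D2])
        fix x assume x: "x \<in> D2" "r (\<kappa> x) = \<zero>"
        then have "\<kappa> x = \<zero>" using r(2) End_zero[OF t(1)] by (auto simp: D2_def)
        then show "x = \<zero>" using x \<kappa>Z by (auto simp: D2_def)
      qed
      show "(\<lambda>x. r (\<kappa> x)) ` D2 \<subseteq> C" using r(2) by (auto simp: D2_def)
    qed
    then have D2': "x = \<zero>" if "x \<in> D1" "\<kappa> x \<in> t ` C" for x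
      using that by (auto simp: D2_def)
    have "D1 \<subseteq> {\<zero>}"
    proof (rule noemb[OF D1])
      show "D1 \<subseteq> D" by (auto simp: D1_def)
      show k: "(\<lambda>x. p (\<kappa> x)) \<in> End" by (rule rmod_hom_compose[OF \<kappa> p(1)])
      show "inj_on (\<lambda>x. p (\<kappa> x)) D1"
        by (rule End_inj_onI[OF k D1]) (use pZ(2) \<kappa>Z D2' in blast)
      show "(\<lambda>x. p (\<kappa> x)) ` D1 \<subseteq> C" using pZ(1) \<kappa>Z by blast
    qed
    then have D1': "x = \<zero>" if "x \<in> D" "\<tau> x \<in> Z <+>\<^bsub>E\<^esub> D" for x
      using that by (auto simp: D1_def)
    \<comment> \<open>With \<open>D1\<close> zero, \<open>\<tau> D\<close> is independent of
      \<open>Z + D\<close>, so \<open>(D, \<tau>)\<close> would enlarge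
      \<open>(C, t)\<close>.\<close>
    show ?thesis
    proof (rule Cmax[OF Ds _ \<tau>(1) _ \<tau>(2)])
      show "D \<subseteq> A" using DB0 B0 by auto
      show "\<tau> ` D \<subseteq> carrier E" by (rule submod_subset[OF End_image[OF \<tau>(1) Ds]])
      show "C \<inter> D \<subseteq> {\<zero>}" using DZ CZ by auto
      show "t ` C \<inter> \<tau> ` D \<subseteq> {\<zero>}"
      proof
        fix y assume y: "y \<in> t ` C \<inter> \<tau> ` D"
        then obtain d where d: "d \<in> D" "y = \<tau> d" by blast
        have "\<tau> d \<in> Z <+>\<^bsub>E\<^esub> D" using y tCZ msum_left[OF Z Ds] unfolding d(2) by blast
        then have "d = \<zero>" by (rule D1'[OF d(1)])
        then show "y \<in> {\<zero>}" using d End_zero[OF \<tau>(1)] by simp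
      qed
      show "(C <+>\<^bsub>E\<^esub> D) \<inter> (t ` C <+>\<^bsub>E\<^esub> \<tau> ` D) \<subseteq> {\<zero>}"
      proof
        fix x assume "x \<in> (C <+>\<^bsub>E\<^esub> D) \<inter> (t ` C <+>\<^bsub>E\<^esub> \<tau> ` D)"
        then obtain c d c' d' where *: "c \<in> C" "d \<in> D" "c' \<in> C" "d' \<in> D"
          "x = c \<oplus> d" "c \<oplus> d = t c' \<oplus> \<tau> d'" by (auto simp: msum_iff)
        note m = submod_mem[OF Ds *(2)] mem(1)[OF *(1)] mem(2)[OF *(3)]
          submod_mem[OF End_image[OF \<tau>(1) Ds] imageI[OF *(4)]]
        have "\<tau> d' = (\<ominus> t c' \<oplus> c) \<oplus> d"
          using m *(6) by (metis M.a_assoc M.add.inv_closed M.r_neg1)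
        moreover have "\<ominus> t c' \<oplus> c \<in> Z"
          using * CZ tCZ by (intro submod_add[OF Z] submod_neg[OF Z]) auto
        ultimately have "d' = \<zero>" using * by (intro D1') (auto intro: msumI)
        then have "c \<oplus> d = t c' \<oplus> \<zero>" using * m End_zero[OF \<tau>(1)] by simp
        then have "c = t c' \<and> d = \<zero>"
          using * CZ tCZ submod_zero[OF Ds] by (intro direct_unique[OF Z Ds DZ(2)]) auto
        then show "x \<in> {\<zero>}" using * CtC m by auto
      qed
    qed
  qed
  show thesis
  proof (rule that[OF dC dC2 dC3 B(1) _ _ _ _ _ nd])
    show "C <+>\<^bsub>E\<^esub> C2 <+>\<^bsub>E\<^esub> (C3 <+>\<^bsub>E\<^esub> B) \<subseteq> A"
      by (rule msum_least[OF A]) (use sub2 sub3 B0(2) in blast)+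
    have "ess (C <+>\<^bsub>E\<^esub> C2 <+>\<^bsub>E\<^esub> (C3 <+>\<^bsub>E\<^esub> B)) (A \<inter> Z <+>\<^bsub>E\<^esub> B0)"
      using B0Z by (intro ess_msum AZ B0 submod_msum C C2 C3 B sub2 sub3 ess2 ess3) auto
    then show "ess (C <+>\<^bsub>E\<^esub> C2 <+>\<^bsub>E\<^esub> (C3 <+>\<^bsub>E\<^esub> B)) A"
      using ess0 A by (rule ess_trans)
    show "C \<inter> C2 \<subseteq> {\<zero>}" "C3 \<inter> B \<subseteq> {\<zero>}" using C2 B by auto
    show "(C <+>\<^bsub>E\<^esub> C2) \<inter> (C3 <+>\<^bsub>E\<^esub> B) \<subseteq> {\<zero>}" using sub2 sub3 B0Z by blast
  qed
qed

end

section \<open>Endomorphisms preserving an automorphism-stable submodule\<close>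

locale stable_submodule = injective_module +
  fixes L
  assumes L: "submod L" and stable: "\<And>a. a \<in> rmod_iso R E E \<Longrightarrow> a ` L \<subseteq> L"
begin

definition pres :: "('c \<Rightarrow> 'c) set" where
  "pres = {h \<in> End. h ` L \<subseteq> L}"

lemma presI: "\<lbrakk>h \<in> End; \<And>x. x \<in> L \<Longrightarrow> h x \<in> L\<rbrakk> \<Longrightarrow> h \<in> pres"
  by (auto simp: pres_def)

lemma presD: "h \<in> pres \<Longrightarrow> h \<in> End" "\<lbrakk>h \<in> pres; x \<in> L\<rbrakk> \<Longrightarrow> h x \<in> L"
  by (auto simp: pres_def)

lemma pres_iso: "a \<in> rmod_iso R E E \<Longrightarrow> a \<in> pres"
  using stable by (auto simp: pres_def rmod_iso_def)

lemma pres_add: "\<lbrakk>h \<in> pres; k \<in> pres\<rbrakk> \<Longrightarrow> (\<lambda>x. h x \<oplus> k x) \<in> pres"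
  by (intro presI End_add submod_add[OF L]) (auto dest: presD)

lemma pres_compose: "\<lbrakk>h \<in> pres; k \<in> pres\<rbrakk> \<Longrightarrow> (\<lambda>x. k (h x)) \<in> pres"
  by (rule presI) (auto intro: rmod_hom_compose dest: presD)

text \<open>\<open>h\<close> is the difference of an automorphism and the identity, both of which
  preserve \<open>L\<close>.\<close>

lemma pres_if_one_plus_iso:
  assumes h: "h \<in> End" and "(\<lambda>x. x \<oplus> h x) \<in> rmod_iso R E E"
  shows "h \<in> pres"
proof (rule presI[OF h])
  fix x assume x: "x \<in> L"
  then have "(x \<oplus> h x) \<ominus> x \<in> L"
    using stable[OF assms(2)] by (intro submod_minus[OF L]) auto
  moreover have "(x \<oplus> h x) \<ominus> x = h x"
    using submod_mem[OF L x] rmod_homD(1)[OF h] M.a_comm[of x "h x"]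
    by (simp add: a_minus_def M.a_assoc M.r_neg)
  ultimately show "h x \<in> L" by simp
qed

text \<open>\<open>1 + h\<close> restricts to the identity on \<open>D\<close>, so it is injective
  there with essential image, and \<open>isoI\<close> applies.\<close>

lemma pres_ess_kernel:
  assumes h: "h \<in> End" and D: "submod D" "ess D (carrier E)" and z: "\<And>x. x \<in> D \<Longrightarrow> h x = \<zero>"
  shows "h \<in> pres"
proof (rule pres_if_one_plus_iso[OF h])
  let ?a = "\<lambda>x. x \<oplus> h x"
  have a: "?a \<in> End" by (rule End_add[OF rmod_hom_id h])
  have eq: "?a x = x" if "x \<in> D" for x using that z submod_mem[OF D(1)] by simp
  then have "inj_on ?a D" "?a ` D = D" by (auto simp: inj_on_def)
  then show "?a \<in> rmod_iso R E E"
    using D by (intro isoI[OF right_module_E a D]) auto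
qed

text \<open>\<open>1 - h\<close> is a two-sided inverse of \<open>1 + h\<close>.\<close>

lemma pres_square_zero:
  assumes h: "h \<in> End" and z: "\<And>x. x \<in> carrier E \<Longrightarrow> h (h x) = \<zero>"
  shows "h \<in> pres"
proof (rule pres_if_one_plus_iso[OF h])
  let ?a = "\<lambda>x. x \<oplus> h x" and ?b = "\<lambda>x. x \<ominus> h x"
  have a: "?a \<in> End" by (rule End_add[OF rmod_hom_id h])
  have b: "?b \<in> End" by (rule End_diff[OF rmod_hom_id h])
  note h' = rmod_homD[OF h] End_minus[OF h]
  have neg0: "\<ominus> \<zero> = \<zero>" using M.minus_equality[of \<zero> \<zero>] by simp
  have "?b (?a x) = x" "?a (?b x) = x" if "x \<in> carrier E" for x
    using that h' z by (simp_all add: a_minus_def M.a_assoc M.r_neg M.l_neg neg0)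
  then have "bij_betw ?a (carrier E) (carrier E)"
    using rmod_homD(1)[OF a] rmod_homD(1)[OF b] by (intro bij_betw_byWitness[of _ ?b]) auto
  then show "?a \<in> rmod_iso R E E" using a by (simp add: rmod_iso_def)
qed

text \<open>With \<open>p\<close> the projection onto a hull of \<open>C\<close> and \<open>q = 1 - p\<close>, a doubling of \<open>C\<close> yields
  \<open>\<sigma> = q \<sigma> p\<close> and \<open>\<rho> = p \<rho> q\<close> with \<open>\<rho> \<sigma> = p\<close>. Hence \<open>p g p = \<rho> (\<sigma> g p)\<close>, and every factor, as
  well as \<open>q g p\<close>, has square zero.\<close>

lemma doubled_extend:
  assumes C: "doubled C" and B: "submod B" and CB: "C \<inter> B \<subseteq> {\<zero>}" and g: "g \<in> End"
  obtains s where "s \<in> pres" "\<And>x. x \<in> C \<Longrightarrow> s x = g x" "\<And>x. x \<in> B \<Longrightarrow> s x = \<zero>"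
proof -
  obtain t where Cs: "submod C" and t: "t \<in> End" "inj_on t C" "C \<inter> t ` C \<subseteq> {\<zero>}"
    using C by (auto simp: doubled_def)
  obtain p where p: "p \<in> End" "\<And>x. x \<in> carrier E \<Longrightarrow> p (p x) = p x"
    and pC: "\<And>x. x \<in> C \<Longrightarrow> p x = x" and pB: "\<And>x. x \<in> B \<Longrightarrow> p x = \<zero>" and ess: "ess C (p ` carrier E)"
    using summand[OF Cs B CB] by blast
  note p' = rmod_homD(1)[OF p(1)] and g' = rmod_homD(1)[OF g] and t' = rmod_homD(1)[OF t(1)]
  define P where "P = p ` carrier E"
  have P: "submod P" unfolding P_def by (rule End_image[OF p(1) submod_carrier])
  have pP: "p x = x" if "x \<in> P" for x using that p(2) by (auto simp: P_def)
  have CP: "C \<subseteq> P" using pC submod_mem[OF Cs] by (force simp: P_def)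
  define q where "q x = x \<ominus> p x" for x
  have q: "q \<in> End" unfolding q_def by (rule End_diff[OF rmod_hom_id p(1)])
  note q' = rmod_homD(1)[OF q]
  have pq: "p (q x) = \<zero>" if "x \<in> carrier E" for x
    using that p p' End_minus[OF p(1)] by (simp add: q_def minus_eq_zero_iff)
  have qp: "q (p x) = \<zero>" if "x \<in> carrier E" for x
    using that p p' by (simp add: q_def minus_eq_zero_iff)
  have qq: "q (q x) = q x" if "x \<in> carrier E" for x
    using that pq[OF that] q' by (simp add: q_def[of "q x"] a_minus_def)
  have pq_sum: "p x \<oplus> q x = x" if "x \<in> carrier E" for x
    using that p' by (simp add: q_def a_minus_def M.a_ac M.r_neg M.r_neg2)
  have qt: "(\<lambda>x. q (t x)) \<in> End" by (rule rmod_hom_compose[OF t(1) q])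
  \<comment> \<open>\<open>q (t x) = \<zero>\<close> means that \<open>t x\<close> lies in
    \<open>P\<close>. As \<open>C\<close> is essential in \<open>P\<close> and misses
    \<open>t C\<close>, the whole of \<open>P\<close> misses \<open>t C\<close>. Hence the submodule
    \<open>X\<close> of all such \<open>x\<close> meets \<open>C\<close> trivially and
    vanishes.\<close>
  have inj: "inj_on (\<lambda>x. q (t x)) P"
  proof (rule End_inj_onI[OF qt P])
    fix x assume x: "x \<in> P" "q (t x) = \<zero>"
    have xc: "x \<in> carrier E" using x submod_mem[OF P] by blast
    have "t x = p (t x)" using x(2) t' p' xc by (simp add: q_def minus_eq_zero_iff)
    then have tx: "t x \<in> P" using t' xc unfolding P_def by blast
    define X where "X = {x \<in> P. t x \<in> P}"
    have X: "submod X" unfolding X_def by (rule End_vimage[OF t(1) P P])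
    have tC: "submod (t ` C)" by (rule End_image[OF t(1) Cs])
    have "P \<inter> t ` C \<subseteq> {\<zero>}"
      by (rule essD[OF ess[folded P_def] submod_Int[OF P tC]]) (use t(3) in blast)+
    then have "X \<inter> C \<subseteq> {\<zero>}"
      using End_inj_onD[OF t(1) Cs t(2)] unfolding X_def by blast
    then have "X \<subseteq> {\<zero>}"
      by (intro essD[OF ess[folded P_def] X]) (auto simp: X_def)
    then show "x = \<zero>" using x tx by (auto simp: X_def)
  qed
  obtain r where r: "r \<in> End" "\<And>x. x \<in> P \<Longrightarrow> r (q (t x)) = x"
    using End_left_inverse[OF P qt inj] by blast
  note r' = rmod_homD(1)[OF r(1)]
  have pres1: "(\<lambda>x. q (h (p x))) \<in> pres" if h: "h \<in> End" for h
  proof (rule pres_square_zero)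
    show "(\<lambda>x. q (h (p x))) \<in> End"
      by (intro rmod_hom_compose[OF _ q] rmod_hom_compose[OF p(1) h])
    show "q (h (p (q (h (p x))))) = \<zero>" if "x \<in> carrier E" for x
      using that pq rmod_homD(1)[OF h] p' End_zero[OF h] End_zero[OF q] by simp
  qed
  have pres2: "(\<lambda>x. p (r (q x))) \<in> pres"
  proof (rule pres_square_zero)
    show "(\<lambda>x. p (r (q x))) \<in> End"
      by (intro rmod_hom_compose[OF _ p(1)] rmod_hom_compose[OF q r(1)])
    show "p (r (q (p (r (q x))))) = \<zero>" if "x \<in> carrier E" for x
      using that qp q' r' End_zero[OF r(1)] End_zero[OF p(1)] by simp
  qed
  have "(\<lambda>x. t (p (g x))) \<in> End"
    by (intro rmod_hom_compose[OF _ t(1)] rmod_hom_compose[OF g p(1)])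
  then have pres3: "(\<lambda>x. p (r (q (q (t (p (g (p x)))))))) \<in> pres"
    using pres_compose[OF pres1 pres2] by blast
  \<comment> \<open>The factors are \<open>\<sigma> = q t p\<close> and
    \<open>\<rho> = p r q\<close>; this is the identity \<open>\<rho> \<sigma> = p\<close>.\<close>
  have pr: "p (r (q (q (t (p y))))) = p y" if "y \<in> carrier E" for y
    using that p' t' q' r(2)[of "p y"] p(2) qq by (simp add: P_def)
  \<comment> \<open>The first summand is \<open>p g p\<close>, so
    \<open>u = (p + q) g p = g p\<close>, which agrees with \<open>g\<close> on \<open>C\<close> and
    vanishes on \<open>B\<close>.\<close>
  define u where "u x = p (r (q (q (t (p (g (p x))))))) \<oplus> q (g (p x))" for x
  have "u \<in> pres"
    unfolding u_def using pres3 pres1[OF g] by (rule pres_add)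
  moreover have u: "u x = g (p x)" if "x \<in> carrier E" for x
    using that pr[of "g (p x)"] pq_sum g' p' by (simp add: u_def)
  have "u x = g x" if "x \<in> C" for x
    using u[of x] pC[OF that] submod_mem[OF Cs that] by simp
  moreover have "u x = \<zero>" if "x \<in> B" for x
    using u[of x] pB[OF that] submod_mem[OF B that] End_zero[OF g] by simp
  ultimately show thesis by (rule that)
qed

text \<open>\<open>s\<close> is corrected by adding a map that equals \<open>f \<ominus> s\<close>
  on \<open>C\<close> and vanishes on \<open>B\<close>; \<open>doubled_extend\<close> provides it
  inside \<open>pres\<close>.\<close>

lemma doubled_sum_extend:
  assumes C: "doubled C" and B: "submod B" and CB: "C \<inter> B \<subseteq> {\<zero>}" and f: "f \<in> End"
    and s: "s \<in> pres" "\<And>x. x \<in> B \<Longrightarrow> s x = f x"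
  obtains s' where "s' \<in> pres" "\<And>x. x \<in> C <+>\<^bsub>E\<^esub> B \<Longrightarrow> s' x = f x"
proof -
  have Cs: "submod C" using C by (simp add: doubled_def)
  note sE = presD(1)[OF s(1)]
  obtain d where d: "d \<in> pres" "\<And>x. x \<in> C \<Longrightarrow> d x = f x \<ominus> s x" "\<And>x. x \<in> B \<Longrightarrow> d x = \<zero>"
    using doubled_extend[OF C B CB End_diff[OF f sE]] by blast
  note dE = presD(1)[OF d(1)]
  have sd: "(\<lambda>x. s x \<oplus> d x) \<in> End" by (rule End_add[OF sE dE])
  have *: "s x \<oplus> d x = f x" if x: "x \<in> C \<or> x \<in> B" for x
  proof -
    have "x \<in> carrier E" using x submod_mem[OF Cs] submod_mem[OF B] by blast
    note m = rmod_homD(1)[OF f this] rmod_homD(1)[OF sE this]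
    show ?thesis
      using x d s(2) m by (auto simp: a_minus_def M.a_ac M.r_neg M.r_neg2)
  qed
  show thesis
  proof (rule that[OF pres_add[OF s(1) d(1)]])
    fix x assume "x \<in> C <+>\<^bsub>E\<^esub> B"
    then obtain c b where cb: "c \<in> C" "b \<in> B" "x = c \<oplus> b" by (auto simp: msum_iff)
    then show "s x \<oplus> d x = f x"
      using rmod_homD(2)[OF sd, of c b] rmod_homD(2)[OF f, of c b] *[of c] *[of b]
        submod_mem[OF Cs] submod_mem[OF B] by simp
  qed
qed

text \<open>Start from an automorphism agreeing with \<open>f\<close> on \<open>B\<close> and add
  \<open>C3\<close>, \<open>C2\<close>, \<open>C1\<close> one at a time. This gives agreement on a
  submodule essential in \<open>A\<close>; the remaining error has an essential kernel and so
  belongs to \<open>pres\<close> itself.\<close>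

lemma pres_of_mono:
  assumes A: "submod A" and f: "f \<in> End" "inj_on f A"
  obtains s where "s \<in> pres" "\<And>x. x \<in> A \<Longrightarrow> s x = f x"
proof -
  obtain C1 C2 C3 B where C: "doubled C1" "doubled C2" "doubled C3" and B: "submod B"
    and sub: "C1 <+>\<^bsub>E\<^esub> C2 <+>\<^bsub>E\<^esub> (C3 <+>\<^bsub>E\<^esub> B) \<subseteq> A"
    and ess: "ess (C1 <+>\<^bsub>E\<^esub> C2 <+>\<^bsub>E\<^esub> (C3 <+>\<^bsub>E\<^esub> B)) A"
    and disj: "C1 \<inter> C2 \<subseteq> {\<zero>}" "C3 \<inter> B \<subseteq> {\<zero>}" "(C1 <+>\<^bsub>E\<^esub> C2) \<inter> (C3 <+>\<^bsub>E\<^esub> B) \<subseteq> {\<zero>}"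
    and nd: "\<And>D. \<lbrakk>doubled D; D \<subseteq> B\<rbrakk> \<Longrightarrow> D \<subseteq> {\<zero>}"
    using doubled_decomposition[OF A] by blast
  have Cs: "submod C1" "submod C2" "submod C3" using C by (auto simp: doubled_def)
  define B1 where "B1 = C3 <+>\<^bsub>E\<^esub> B"
  define B2 where "B2 = C2 <+>\<^bsub>E\<^esub> B1"
  define D where "D = C1 <+>\<^bsub>E\<^esub> C2 <+>\<^bsub>E\<^esub> B1"
  have B1: "submod B1" unfolding B1_def by (intro submod_msum Cs B)
  have B2: "submod B2" unfolding B2_def by (intro submod_msum Cs B1)
  have C12: "submod (C1 <+>\<^bsub>E\<^esub> C2)" by (intro submod_msum Cs)
  have D: "submod D" unfolding D_def by (intro submod_msum C12 B1)
  have inC: "C1 \<subseteq> C1 <+>\<^bsub>E\<^esub> C2" "C2 \<subseteq> C1 <+>\<^bsub>E\<^esub> C2"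
    using msum_left[OF Cs(1,2)] msum_right[OF Cs(1,2)] by auto
  have disj': "(C1 <+>\<^bsub>E\<^esub> C2) \<inter> B1 \<subseteq> {\<zero>}" using disj(3) by (simp add: B1_def)
  have BA: "B \<subseteq> A"
    using sub msum_right[OF Cs(3) B] msum_right[OF C12 B1] by (auto simp: B1_def)
  obtain a where a: "a \<in> rmod_iso R E E" "\<And>x. x \<in> B \<Longrightarrow> a x = f x"
    using iso_extend_if_not_doubled[OF B f(1) inj_on_subset[OF f(2) BA] nd] by blast
  obtain s1 where s1: "s1 \<in> pres" "\<And>x. x \<in> B1 \<Longrightarrow> s1 x = f x"
    using doubled_sum_extend[OF C(3) B disj(2) f(1) pres_iso[OF a(1)] a(2)] unfolding B1_def by blast
  have "C2 \<inter> B1 \<subseteq> {\<zero>}" using disj' inC by blast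
  then obtain s2 where s2: "s2 \<in> pres" "\<And>x. x \<in> B2 \<Longrightarrow> s2 x = f x"
    using doubled_sum_extend[OF C(2) B1 _ f(1) s1] unfolding B2_def by blast
  have "C1 \<inter> B2 \<subseteq> {\<zero>}"
  proof
    fix x assume "x \<in> C1 \<inter> B2"
    then obtain c b where x: "x \<in> C1" "c \<in> C2" "b \<in> B1" "c \<oplus> b = x" by (auto simp: B2_def msum_iff)
    then have "c \<oplus> b = x \<oplus> \<zero>" using submod_mem[OF Cs(1)] by simp
    then have "c = x \<and> b = \<zero>"
      using x inC submod_zero[OF B1] by (intro direct_unique[OF C12 B1 disj']) auto
    then show "x \<in> {\<zero>}" using x disj(1) by blast
  qed
  then obtain s3 where s3: "s3 \<in> pres" "\<And>x. x \<in> C1 <+>\<^bsub>E\<^esub> B2 \<Longrightarrow> s3 x = f x"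
    using doubled_sum_extend[OF C(1) B2 _ f(1) s2] by blast
  have "D \<subseteq> C1 <+>\<^bsub>E\<^esub> B2"
    unfolding D_def B2_def
    using msum_left[OF Cs(1) B2] msum_right[OF Cs(1) B2] msum_left[OF Cs(2) B1] msum_right[OF Cs(2) B1]
    by (intro msum_least submod_msum Cs B1) (auto simp: B2_def)
  then have s3D: "s3 x = f x" if "x \<in> D" for x using that s3(2) by blast
  have DA: "D \<subseteq> A" and essD: "ess D A" using sub ess by (auto simp: D_def B1_def)
  note s3E = presD(1)[OF s3(1)]
  obtain V where V: "submod V" "V \<inter> A = {\<zero>}" "ess (A <+>\<^bsub>E\<^esub> V) (carrier E)"
    by (rule ess_complement_exists[OF submod_carrier A submod_subset[OF A]]) blast
  have AV: "A \<inter> V \<subseteq> {\<zero>}" using V by auto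
  \<comment> \<open>\<open>j\<close> is the error of \<open>s3\<close> on \<open>A\<close>. It
    vanishes on \<open>D\<close> and on the complement \<open>V\<close>, and \<open>D + V\<close> is
    essential in \<open>E\<close>.\<close>
  obtain j where j: "j \<in> End" "\<And>x. x \<in> A \<Longrightarrow> j x = f x \<ominus> s3 x" "\<And>x. x \<in> V \<Longrightarrow> j x = \<zero>"
    using glue_endo[OF A V(1) AV End_diff[OF f(1) s3E] End_const_zero] by blast
  have "j \<in> pres"
  proof (rule pres_ess_kernel[OF j(1)])
    show "submod (D <+>\<^bsub>E\<^esub> V)" by (intro submod_msum D V)
    have "ess (D <+>\<^bsub>E\<^esub> V) (A <+>\<^bsub>E\<^esub> V)"
      by (rule ess_msum[OF A V(1) AV D V(1) DA order_refl essD ess_refl[OF V(1)]])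
    then show "ess (D <+>\<^bsub>E\<^esub> V) (carrier E)" using V(3) submod_carrier by (rule ess_trans)
    fix x assume "x \<in> D <+>\<^bsub>E\<^esub> V"
    then obtain d v where dv: "d \<in> D" "v \<in> V" "x = d \<oplus> v" by (auto simp: msum_iff)
    note m = submod_mem[OF D dv(1)] submod_mem[OF V(1) dv(2)]
    have "j d = \<zero>"
      using dv DA j(2)[of d] s3D rmod_homD(1)[OF f(1) m(1)] by (auto simp: a_minus_def M.r_neg)
    then show "j x = \<zero>" using dv m j(3) rmod_homD(2)[OF j(1)] by simp
  qed
  moreover have "s3 x \<oplus> j x = f x" if "x \<in> A" for x
    using that j(2) rmod_homD(1)[OF f(1)] rmod_homD(1)[OF s3E] submod_mem[OF A]
    by (simp add: a_minus_def M.a_ac M.r_neg M.r_neg2)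
  ultimately show thesis using pres_add[OF s3(1)] that by blast
qed

text \<open>On \<open>A\<close> the map \<open>f\<close> agrees with an endomorphism preserving
  \<open>L\<close>.\<close>

lemma mono_into_stable:
  assumes "submod A" "A \<subseteq> L" "f \<in> End" "inj_on f A"
  shows "f ` A \<subseteq> L"
proof -
  obtain s where "s \<in> pres" "\<And>x. x \<in> A \<Longrightarrow> s x = f x"
    using pres_of_mono[OF assms(1,3,4)] by blast
  then show ?thesis using assms(2) presD(2) by fastforce
qed

end

section \<open>Isomorphic injective envelopes\<close>

text \<open>Bumby's argument. With \<open>h = g f\<close>, \<open>F = g N\<close> and \<open>C\<close> a complement of \<open>F\<close> in \<open>M\<close>, let \<open>P\<close> be
  the least \<open>h\<close>-stable submodule containing \<open>C\<close>, so that \<open>P = C + h P\<close>, and let \<open>Y\<close> be a complement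
  of \<open>h P\<close> in \<open>F\<close>. Then \<open>P + Y\<close> is essential in \<open>M\<close>, and \<open>f\<close> on \<open>P\<close> together with the inverse of
  \<open>g\<close> on \<open>Y\<close> maps it isomorphically onto an essential submodule of \<open>N\<close>.\<close>

lemma envelopes_isomorphic:
  fixes M :: "('r, 'm) right_module" and N :: "('r, 'n) right_module"
    and E :: "('r, 'e) right_module" and E' :: "('r, 'f) right_module"
  assumes u: "injective_envelope R M E u" and v: "injective_envelope R N E' v"
    and f: "f \<in> rmod_mon R M N" and g: "g \<in> rmod_mon R N M"
  obtains \<Theta> where "\<Theta> \<in> rmod_iso R E E'"
proof -
  have mods: "right_module R M" "right_module R N" "right_module R E" "right_module R E'"
    using u v by (auto simp: injective_envelope_def injective_rmod_def)
  interpret M: right_module R M by fact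
  interpret N: right_module R N by fact
  interpret E: injective_module R E
    using u by (intro injective_module.intro injective_module_axioms.intro mods)
      (simp add: injective_envelope_def)
  interpret E': injective_module R E'
    using v by (intro injective_module.intro injective_module_axioms.intro mods)
      (simp add: injective_envelope_def)
  have uh: "u \<in> rmod_hom R M E" "inj_on u (carrier M)" and vh: "v \<in> rmod_hom R N E'" "inj_on v (carrier N)"
    and fh: "f \<in> rmod_hom R M N" "inj_on f (carrier M)" and gh: "g \<in> rmod_hom R N M" "inj_on g (carrier N)"
    using u v f g by (auto simp: injective_envelope_def rmod_mon_def)
  have uM: "E.submod (u ` carrier M)" "E.ess (u ` carrier M) (carrier E)"
    and vN: "E'.submod (v ` carrier N)" "E'.ess (v ` carrier N) (carrier E')"
    using u v by (auto simp: injective_envelope_def E.essential_in_iff E'.essential_in_iff)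
  note f' = rmod_homD[OF fh(1)] and g' = rmod_homD[OF gh(1)] and u' = rmod_homD[OF uh(1)] and v' = rmod_homD[OF vh(1)]

  define h where "h x = g (f x)" for x
  have h: "h \<in> rmod_hom R M M" unfolding h_def by (rule rmod_hom_compose[OF fh(1) gh(1)])
  note h' = rmod_homD[OF h]
  have h_inj: "inj_on h (carrier M)"
    using fh(2) gh(2) f'(1) by (auto simp: h_def inj_on_def)
  define F where "F = g ` carrier N"
  have F: "M.submod F"
    unfolding F_def by (rule submod_image[OF mods(2,1) _ N.submod_carrier]) (use gh in simp)
  have hF: "h x \<in> F" if "x \<in> carrier M" for x using that f'(1) by (auto simp: h_def F_def)
  obtain C where C: "M.submod C" "C \<subseteq> carrier M" "C \<inter> F = {\<zero>\<^bsub>M\<^esub>}" "M.ess (F <+>\<^bsub>M\<^esub> C) (carrier M)"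
    by (rule M.ess_complement_exists[OF M.submod_carrier F M.submod_subset[OF F]])
  define P where "P = \<Inter>{X. M.submod X \<and> C \<subseteq> X \<and> h ` X \<subseteq> X}"
  have PI: "P \<subseteq> X" if "M.submod X" "C \<subseteq> X" "h ` X \<subseteq> X" for X
    using that unfolding P_def by blast
  have CP: "C \<subseteq> P" and hP: "h ` P \<subseteq> P" unfolding P_def by blast+
  have PM: "P \<subseteq> carrier M" using C h'(1) by (intro PI) auto
  have P: "M.submod P"
  proof (rule M.submodI[OF PM])
    show "\<zero>\<^bsub>M\<^esub> \<in> P" using CP M.submod_zero[OF C(1)] by blast
  qed (auto simp: P_def intro: M.submod_add M.submod_smult)
  have hPs: "M.submod (h ` P)"
    by (rule submod_image[OF mods(1,1) rmod_hom_restrict[OF h PM] P])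
  have ChP: "M.submod (C <+>\<^bsub>M\<^esub> h ` P)" by (intro M.submod_msum C hPs)
  have sub: "C <+>\<^bsub>M\<^esub> h ` P \<subseteq> P" by (rule M.msum_least[OF P CP hP])
  \<comment> \<open>\<open>C + h P\<close> contains \<open>C\<close> and, lying in \<open>P\<close>,
    is mapped by \<open>h\<close> into \<open>h P\<close>. So it is one of the submodules whose
    intersection is \<open>P\<close>.\<close>
  then have Peq: "P = C <+>\<^bsub>M\<^esub> h ` P"
    using M.msum_left[OF C(1) hPs] M.msum_right[OF C(1) hPs] by (intro subset_antisym PI ChP) auto
  have hPF: "h ` P \<subseteq> F" using hF PM by auto
  obtain Y where Y: "M.submod Y" "Y \<subseteq> F" "Y \<inter> h ` P = {\<zero>\<^bsub>M\<^esub>}" "M.ess (h ` P <+>\<^bsub>M\<^esub> Y) F"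
    by (rule M.ess_complement_exists[OF F hPs hPF])
  \<comment> \<open>Write \<open>y\<close> as \<open>c \<oplus> p\<close> by \<open>Peq\<close>.
    Both \<open>y\<close> and \<open>p\<close> lie in \<open>F\<close>, which is independent of
    \<open>C\<close>, so \<open>c\<close> vanishes and \<open>y\<close> lies in \<open>h P\<close>,
    which \<open>Y\<close> misses.\<close>
  have PY: "P \<inter> Y \<subseteq> {\<zero>\<^bsub>M\<^esub>}"
  proof
    fix y assume y: "y \<in> P \<inter> Y"
    then have "y \<in> C <+>\<^bsub>M\<^esub> h ` P" using Peq by blast
    then obtain c p where cp: "c \<in> C" "p \<in> h ` P" "c \<oplus>\<^bsub>M\<^esub> p = y"
      unfolding M.msum_iff by blast
    have "c \<oplus>\<^bsub>M\<^esub> p = \<zero>\<^bsub>M\<^esub> \<oplus>\<^bsub>M\<^esub> y" using cp(3) y M.submod_mem[OF Y(1)] by simp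
    moreover have "C \<inter> F \<subseteq> {\<zero>\<^bsub>M\<^esub>}" by (simp add: C(3))
    moreover have "p \<in> F" by (rule subsetD[OF hPF cp(2)])
    moreover have "y \<in> F" using y Y(2) by blast
    ultimately have "c = \<zero>\<^bsub>M\<^esub> \<and> p = y"
      using cp(1) M.submod_zero[OF C(1)] by (intro M.direct_unique[OF C(1) F, of c _ p y])
    then have "y \<in> Y \<inter> h ` P" using y cp(2) by simp
    then show "y \<in> {\<zero>\<^bsub>M\<^esub>}" unfolding Y(3) .
  qed
  have PYs: "M.submod (P <+>\<^bsub>M\<^esub> Y)" by (intro M.submod_msum P Y)
  have hPY: "M.submod (h ` P <+>\<^bsub>M\<^esub> Y)" by (intro M.submod_msum hPs Y)
  \<comment> \<open>\<open>h P + Y\<close> is essential in \<open>F\<close>, and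
    \<open>F + C\<close> in \<open>M\<close>; hence \<open>h P + Y + C\<close>, which lies in
    \<open>P + Y\<close>, is essential in \<open>M\<close>.\<close>
  have ess: "M.ess (P <+>\<^bsub>M\<^esub> Y) (carrier M)"
  proof -
    have FC: "F \<inter> C \<subseteq> {\<zero>\<^bsub>M\<^esub>}" using C(3) by blast
    have "h ` P <+>\<^bsub>M\<^esub> Y \<subseteq> F" by (rule M.msum_least[OF F hPF Y(2)])
    then have "M.ess (h ` P <+>\<^bsub>M\<^esub> Y <+>\<^bsub>M\<^esub> C) (F <+>\<^bsub>M\<^esub> C)"
      by (intro M.ess_msum[OF F C(1) FC hPY C(1)] order_refl Y(4) M.ess_refl C(1))
    then have "M.ess (h ` P <+>\<^bsub>M\<^esub> Y <+>\<^bsub>M\<^esub> C) (carrier M)"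
      using C(4) M.submod_carrier by (rule M.ess_trans)
    moreover have "h ` P <+>\<^bsub>M\<^esub> Y <+>\<^bsub>M\<^esub> C \<subseteq> P <+>\<^bsub>M\<^esub> Y"
      using hP CP M.msum_left[OF P Y(1)] M.msum_right[OF P Y(1)]
      by (intro M.msum_least PYs) auto
    ultimately show ?thesis unfolding M.ess_def by blast
  qed

  \<comment> \<open>\<open>k\<close> is \<open>v\<close> after the inverse of \<open>g\<close>,
    extended from \<open>F\<close> to all of \<open>M\<close>.\<close>
  obtain k where k: "k \<in> rmod_hom R M E'" "\<And>x. x \<in> carrier N \<Longrightarrow> k (g x) = v x"
    using injective_rmod_extend[OF E'.injective mods(2,1) g vh(1)] by blast
  have vf: "(\<lambda>x. v (f x)) \<in> rmod_hom R M E'" by (rule rmod_hom_compose[OF fh(1) vh(1)])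
  obtain w where w: "w \<in> rmod_hom R M E'" "\<And>x. x \<in> P \<Longrightarrow> w x = v (f x)" "\<And>x. x \<in> Y \<Longrightarrow> w x = k x"
    by (rule E'.glue[OF mods(1) P Y(1) PY rmod_hom_restrict[OF vf PM]
          rmod_hom_restrict[OF k(1) M.submod_subset[OF Y(1)]]]) (rule that)
  have Fc: "F \<subseteq> carrier M" by (rule M.submod_subset[OF F])
  have k_inj: "inj_on k F" using k(2) vh(2) by (auto simp: F_def inj_on_def)
  \<comment> \<open>On \<open>P\<close> one has \<open>v f = k g f = k h\<close>. Thus
    \<open>w\<close> is \<open>k\<close> after the isomorphism of \<open>P + Y\<close> onto
    \<open>h P + Y\<close> given by \<open>h\<close> and the identity, and its injectivity and image
    reduce to those of \<open>k\<close> on \<open>F\<close>.\<close>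
  have w_sum: "w (p \<oplus>\<^bsub>M\<^esub> y) = k (h p \<oplus>\<^bsub>M\<^esub> y)" if "p \<in> P" "y \<in> Y" for p y
  proof -
    have m: "p \<in> carrier M" "y \<in> carrier M" using that PM M.submod_mem[OF Y(1)] by auto
    then show ?thesis
      using that w rmod_homD(2)[OF w(1) m] rmod_homD(2)[OF k(1) h'(1)[OF m(1)] m(2)] k(2) f'(1)
      by (simp add: h_def)
  qed
  have Wimg: "w ` (P <+>\<^bsub>M\<^esub> Y) = k ` (h ` P <+>\<^bsub>M\<^esub> Y)"
  proof
    show "w ` (P <+>\<^bsub>M\<^esub> Y) \<subseteq> k ` (h ` P <+>\<^bsub>M\<^esub> Y)"
      using w_sum by (fastforce simp: M.msum_iff)
    show "k ` (h ` P <+>\<^bsub>M\<^esub> Y) \<subseteq> w ` (P <+>\<^bsub>M\<^esub> Y)"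
    proof
      fix z assume "z \<in> k ` (h ` P <+>\<^bsub>M\<^esub> Y)"
      then obtain p y where "p \<in> P" "y \<in> Y" "z = k (h p \<oplus>\<^bsub>M\<^esub> y)" by (auto simp: M.msum_iff)
      then show "z \<in> w ` (P <+>\<^bsub>M\<^esub> Y)"
        using w_sum by (intro image_eqI[of _ _ "p \<oplus>\<^bsub>M\<^esub> y"]) (auto intro: M.msumI)
    qed
  qed
  have w_inj: "inj_on w (P <+>\<^bsub>M\<^esub> Y)"
  proof (rule rmod_hom_inj_onI[OF mods(1,4) w(1) PYs])
    fix x assume "x \<in> P <+>\<^bsub>M\<^esub> Y" "w x = \<zero>\<^bsub>E'\<^esub>"
    then obtain p y where x: "p \<in> P" "y \<in> Y" "x = p \<oplus>\<^bsub>M\<^esub> y" "k (h p \<oplus>\<^bsub>M\<^esub> y) = \<zero>\<^bsub>E'\<^esub>"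
      using w_sum by (auto simp: M.msum_iff)
    have "h p \<oplus>\<^bsub>M\<^esub> y \<in> F" using x Y(2) hPF by (intro M.submod_add[OF F]) auto
    then have "h p \<oplus>\<^bsub>M\<^esub> y = \<zero>\<^bsub>M\<^esub>"
      by (rule rmod_hom_inj_onD[OF mods(1,4) k(1) F k_inj _ x(4)])
    then have z: "h p = \<zero>\<^bsub>M\<^esub>" "y = \<zero>\<^bsub>M\<^esub>"
      using x Y(3) M.direct_zero[OF hPs Y(1), of "h p" y] by auto
    then have "p = \<zero>\<^bsub>M\<^esub>"
      using rmod_hom_inj_onD[OF mods(1,1) h M.submod_carrier h_inj] x PM by blast
    then show "x = \<zero>\<^bsub>M\<^esub>" using x z by simp
  qed
  have kF: "k ` F = v ` carrier N" unfolding F_def image_image using k(2) by (rule image_cong[OF refl])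
  \<comment> \<open>\<open>k\<close> restricts to an isomorphism of \<open>F\<close> onto
    \<open>v N\<close>, so it carries the essential submodule \<open>h P + Y\<close> of
    \<open>F\<close> to one of \<open>v N\<close>.\<close>
  have "E'.ess (k ` (h ` P <+>\<^bsub>M\<^esub> Y)) (k ` F)"
    unfolding E'.ess_def
  proof (intro ballI impI)
    fix a assume "a \<in> k ` F" "a \<noteq> \<zero>\<^bsub>E'\<^esub>"
    then obtain x where x: "x \<in> F" "a = k x" "x \<noteq> \<zero>\<^bsub>M\<^esub>"
      using rmod_hom_zero[OF mods(1,4) k(1)] by auto
    then obtain r where r: "r \<in> carrier R" "x \<cdot>\<^bsub>M\<^esub> r \<in> h ` P <+>\<^bsub>M\<^esub> Y" "x \<cdot>\<^bsub>M\<^esub> r \<noteq> \<zero>\<^bsub>M\<^esub>"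
      using Y(4) unfolding M.ess_def by blast
    have eq: "a \<cdot>\<^bsub>E'\<^esub> r = k (x \<cdot>\<^bsub>M\<^esub> r)" using x r Fc rmod_homD(3)[OF k(1), of x r] by auto
    have "x \<cdot>\<^bsub>M\<^esub> r \<in> F" using x r M.submod_smult[OF F] by blast
    then have "k (x \<cdot>\<^bsub>M\<^esub> r) \<noteq> \<zero>\<^bsub>E'\<^esub>"
      using rmod_hom_inj_onD[OF mods(1,4) k(1) F k_inj] r(3) by blast
    then show "\<exists>r\<in>carrier R. a \<cdot>\<^bsub>E'\<^esub> r \<in> k ` (h ` P <+>\<^bsub>M\<^esub> Y) \<and> a \<cdot>\<^bsub>E'\<^esub> r \<noteq> \<zero>\<^bsub>E'\<^esub>"
      using r eq by auto
  qed
  then have essw: "E'.ess (w ` (P <+>\<^bsub>M\<^esub> Y)) (carrier E')"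
    unfolding Wimg kF using vN(2) E'.submod_carrier by (rule E'.ess_trans)

  \<comment> \<open>Extend \<open>w\<close> along \<open>u\<close>. On the essential submodule
    \<open>u (P + Y)\<close> the extension acts as \<open>w\<close>, which is injective with
    essential image, so \<open>isoI\<close> makes it an isomorphism.\<close>
  have "u \<in> rmod_mon R M E" using uh by (simp add: rmod_mon_def)
  then obtain \<Theta> where \<Theta>: "\<Theta> \<in> rmod_hom R E E'" "\<And>x. x \<in> carrier M \<Longrightarrow> \<Theta> (u x) = w x"
    using injective_rmod_extend[OF E'.injective mods(1,3) _ w(1)] by blast
  let ?D = "u ` (P <+>\<^bsub>M\<^esub> Y)"
  have PYc: "P <+>\<^bsub>M\<^esub> Y \<subseteq> carrier M" by (rule M.submod_subset[OF PYs])
  have D: "E.submod ?D" by (rule submod_image[OF mods(1,3) rmod_hom_restrict[OF uh(1) PYc] PYs])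
  have "E.ess ?D (u ` carrier M)"
    unfolding E.ess_def
  proof (intro ballI impI)
    fix a assume "a \<in> u ` carrier M" "a \<noteq> \<zero>\<^bsub>E\<^esub>"
    then obtain x where x: "x \<in> carrier M" "a = u x" "x \<noteq> \<zero>\<^bsub>M\<^esub>"
      using rmod_hom_zero[OF mods(1,3) uh(1)] by auto
    then obtain r where r: "r \<in> carrier R" "x \<cdot>\<^bsub>M\<^esub> r \<in> P <+>\<^bsub>M\<^esub> Y" "x \<cdot>\<^bsub>M\<^esub> r \<noteq> \<zero>\<^bsub>M\<^esub>"
      using ess unfolding M.ess_def by blast
    have eq: "a \<cdot>\<^bsub>E\<^esub> r = u (x \<cdot>\<^bsub>M\<^esub> r)" using x(2) u'(3)[OF x(1) r(1)] by simp
    have "u (x \<cdot>\<^bsub>M\<^esub> r) \<noteq> \<zero>\<^bsub>E\<^esub>"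
      using rmod_hom_inj_onD[OF mods(1,3) uh(1) M.submod_carrier uh(2)] r x by blast
    then show "\<exists>r\<in>carrier R. a \<cdot>\<^bsub>E\<^esub> r \<in> ?D \<and> a \<cdot>\<^bsub>E\<^esub> r \<noteq> \<zero>\<^bsub>E\<^esub>"
      using r unfolding eq[symmetric] by (metis eq imageI)
  qed
  then have essD: "E.ess ?D (carrier E)" using uM(2) E.submod_carrier by (rule E.ess_trans)
  have "inj_on \<Theta> ?D"
  proof (rule inj_onI)
    fix a b assume "a \<in> ?D" "b \<in> ?D" and eq: "\<Theta> a = \<Theta> b"
    then obtain x y where xy: "x \<in> P <+>\<^bsub>M\<^esub> Y" "y \<in> P <+>\<^bsub>M\<^esub> Y" "a = u x" "b = u y" by blast
    moreover from this have "x \<in> carrier M" "y \<in> carrier M" using PYc by blast+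
    ultimately have "w x = w y" using eq \<Theta>(2) by metis
    then show "a = b" using xy w_inj by (auto dest: inj_onD)
  qed
  moreover have "\<Theta> ` ?D = w ` (P <+>\<^bsub>M\<^esub> Y)"
    unfolding image_image using \<Theta>(2) PYc by (intro image_cong) auto
  ultimately have "\<Theta> \<in> rmod_iso R E E'"
    using essw by (intro E.isoI[OF mods(4) \<Theta>(1) D essD]) auto
  then show thesis by (rule that)
qed

text \<open>Both \<open>\<Theta> u\<close> and \<open>v f\<close> embed \<open>M\<close> into
  \<open>E'\<close>. Extending the former along the latter yields an endomorphism \<open>k\<close>
  of \<open>E'\<close> that is injective on \<open>v f M\<close>, a submodule of \<open>v N\<close>;
  \<open>mono_into_stable\<close> then keeps its image inside \<open>v N\<close>.\<close>

lemma envelope_iso_maps_into: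
  assumes M: "injective_envelope R M E u" and N: "automorphism_invariant R N E' v"
    and f: "f \<in> rmod_mon R M N" and \<Theta>: "\<Theta> \<in> rmod_iso R E E'"
  shows "\<Theta> ` u ` carrier M \<subseteq> v ` carrier N"
proof -
  have env: "injective_envelope R N E' v" using N by (simp add: automorphism_invariant_def)
  have mods: "right_module R M" "right_module R N" "right_module R E" "right_module R E'"
    using M env by (auto simp: injective_envelope_def injective_rmod_def)
  have vh: "v \<in> rmod_hom R N E'" "inj_on v (carrier N)" and uh: "u \<in> rmod_hom R M E" "inj_on u (carrier M)"
    and fh: "f \<in> rmod_hom R M N" "inj_on f (carrier M)"
    and \<Theta>h: "\<Theta> \<in> rmod_hom R E E'" "inj_on \<Theta> (carrier E)"
    using M env f \<Theta> by (auto simp: injective_envelope_def rmod_mon_def rmod_iso_def bij_betw_def)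
  note f' = rmod_homD[OF fh(1)] and u' = rmod_homD[OF uh(1)]
  interpret M: right_module R M by fact
  interpret E': injective_module R E'
    using env by (intro injective_module.intro injective_module_axioms.intro mods)
      (simp add: injective_envelope_def)
  \<comment> \<open>For an automorphism \<open>a\<close>, invariance gives an endomorphism
    \<open>b\<close> of \<open>N\<close> with \<open>v b = a v\<close>, so \<open>a\<close> maps
    \<open>v N\<close> into itself.\<close>
  interpret S: stable_submodule R E' "v ` carrier N"
  proof
    show "E'.submod (v ` carrier N)"
      using env by (auto simp: injective_envelope_def E'.essential_in_iff)
    fix a assume "a \<in> rmod_iso R E' E'"
    then obtain b where "b \<in> rmod_hom R N N" "\<And>x. x \<in> carrier N \<Longrightarrow> v (b x) = a (v x)"
      using N by (auto simp: automorphism_invariant_def)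
    then show "a ` v ` carrier N \<subseteq> v ` carrier N"
      using rmod_homD(1)[of b R N N] by (fastforce intro: rev_image_eqI)
  qed
  let ?i = "\<lambda>x. v (f x)" and ?h = "\<lambda>x. \<Theta> (u x)"
  have i: "?i \<in> rmod_hom R M E'" by (rule rmod_hom_compose[OF fh(1) vh(1)])
  moreover have "inj_on ?i (carrier M)"
    using fh(2) vh(2) f'(1) by (auto simp: inj_on_def)
  ultimately have "?i \<in> rmod_mon R M E'" by (simp add: rmod_mon_def)
  moreover have "?h \<in> rmod_hom R M E'" by (rule rmod_hom_compose[OF uh(1) \<Theta>h(1)])
  ultimately obtain k where k: "k \<in> rmod_hom R E' E'" "\<And>x. x \<in> carrier M \<Longrightarrow> k (v (f x)) = \<Theta> (u x)"
    using injective_rmod_extend[OF E'.injective mods(1,4)] by blast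
  have "k ` ?i ` carrier M \<subseteq> v ` carrier N"
  proof (rule S.mono_into_stable)
    show "E'.submod (?i ` carrier M)"
      by (rule submod_image[OF mods(1,4) _ M.submod_carrier]) (use i in simp)
    show "?i ` carrier M \<subseteq> v ` carrier N" using f'(1) by auto
    show "inj_on k (?i ` carrier M)"
    proof (rule inj_onI)
      fix a b assume "a \<in> ?i ` carrier M" "b \<in> ?i ` carrier M" "k a = k b"
      then obtain x y where xy: "x \<in> carrier M" "y \<in> carrier M" "a = ?i x" "b = ?i y"
        and "\<Theta> (u x) = \<Theta> (u y)"
        using k(2) by auto
      then have "u x = u y" using u'(1) by (intro inj_onD[OF \<Theta>h(2)])
      then have "x = y" using xy by (intro inj_onD[OF uh(2)])
      then show "a = b" using xy by simp
    qed
  qed (rule k(1))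
  then show ?thesis using k(2) by (auto simp: image_subset_iff)
qed

section \<open>The isomorphism of \<open>M\<close> and \<open>N\<close>\<close>

lemma rmod_iso_inv_into:
  assumes "right_module R A" "right_module R B" "h \<in> rmod_iso R A B"
  shows "inv_into (carrier A) h \<in> rmod_iso R B A"
proof -
  interpret A: right_module R A by fact
  have h: "h \<in> rmod_hom R A B" "bij_betw h (carrier A) (carrier B)"
    using assms(3) by (auto simp: rmod_iso_def)
  note h' = rmod_homD[OF h(1)]
  let ?k = "inv_into (carrier A) h"
  have bij: "bij_betw ?k (carrier B) (carrier A)" by (rule bij_betw_inv_into[OF h(2)])
  have kh: "?k (h x) = x" if "x \<in> carrier A" for x
    using that h(2) by (simp add: bij_betw_def)
  have hk: "h (?k y) = y" and kA: "?k y \<in> carrier A" if "y \<in> carrier B" for y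
    using that h(2) bij by (auto simp: bij_betw_def f_inv_into_f)
  have "?k \<in> rmod_hom R B A"
  proof (rule rmod_homI)
    show "?k (x \<oplus>\<^bsub>B\<^esub> y) = ?k x \<oplus>\<^bsub>A\<^esub> ?k y" if "x \<in> carrier B" "y \<in> carrier B" for x y
      using kh[of "?k x \<oplus>\<^bsub>A\<^esub> ?k y"] that h'(2) hk kA by simp
    show "?k (x \<cdot>\<^bsub>B\<^esub> r) = ?k x \<cdot>\<^bsub>A\<^esub> r" if "x \<in> carrier B" "r \<in> carrier R" for x r
      using kh[of "?k x \<cdot>\<^bsub>A\<^esub> r"] that h'(3) hk kA by simp
  qed (rule kA)
  then show ?thesis using bij by (simp add: rmod_iso_def)
qed

theorem theorem3p1:
  fixes R :: "('r, 'x) ring_scheme"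
    and M :: "('r, 'm) right_module" and N :: "('r, 'n) right_module"
    and EM :: "('r, 'e) right_module" and EN :: "('r, 'f) right_module"
    and u :: "'m \<Rightarrow> 'e" and v :: "'n \<Rightarrow> 'f"
    and f :: "'m \<Rightarrow> 'n" and g :: "'n \<Rightarrow> 'm"
  assumes "ring R" and "right_module R M" and "right_module R N"
    and "automorphism_invariant R M EM u" and "automorphism_invariant R N EN v"
    and "f \<in> rmod_mon R M N" and "g \<in> rmod_mon R N M"
  shows "rmod_isomorphic R M N"
proof -
  have env: "injective_envelope R M EM u" "injective_envelope R N EN v"
    using assms by (auto simp: automorphism_invariant_def)
  then have mods: "right_module R EM" "right_module R EN"
    and uh: "u \<in> rmod_hom R M EM" "inj_on u (carrier M)"
    and vh: "v \<in> rmod_hom R N EN" "inj_on v (carrier N)"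
    by (auto simp: injective_envelope_def injective_rmod_def rmod_mon_def)
  obtain \<Theta> where \<Theta>: "\<Theta> \<in> rmod_iso R EM EN"
    using envelopes_isomorphic[OF env assms(6,7)] by blast
  have \<Theta>h: "\<Theta> \<in> rmod_hom R EM EN" "bij_betw \<Theta> (carrier EM) (carrier EN)"
    using \<Theta> by (auto simp: rmod_iso_def)
  note u' = rmod_homD[OF uh(1)] and v' = rmod_homD[OF vh(1)]
  define \<Phi> where "\<Phi> = inv_into (carrier EM) \<Theta>"
  have \<Phi>: "\<Phi> \<in> rmod_iso R EN EM" unfolding \<Phi>_def by (rule rmod_iso_inv_into[OF mods \<Theta>])
  have 1: "\<Theta> ` u ` carrier M \<subseteq> v ` carrier N"
    by (rule envelope_iso_maps_into[OF env(1) assms(5,6) \<Theta>])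
  have 2: "\<Phi> ` v ` carrier N \<subseteq> u ` carrier M"
    by (rule envelope_iso_maps_into[OF env(2) assms(4,7) \<Phi>])
  have \<Theta>\<Phi>: "\<Theta> (\<Phi> y) = y" if "y \<in> carrier EN" for y
    using that \<Theta>h(2) by (simp add: \<Phi>_def bij_betw_def f_inv_into_f)
  \<comment> \<open>\<open>k\<close> is \<open>\<Theta>\<close> read through the embeddings. As
    \<open>v\<close> is injective, the relation \<open>v k = \<Theta> u\<close> transfers linearity
    and injectivity from \<open>\<Theta> u\<close> to \<open>k\<close>.\<close>
  define k where "k x = inv_into (carrier N) v (\<Theta> (u x))" for x
  have kN: "k x \<in> carrier N" and vk: "v (k x) = \<Theta> (u x)" if "x \<in> carrier M" for x
    using 1 that unfolding k_def by (auto intro!: inv_into_into f_inv_into_f)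
  interpret M: right_module R M by fact
  interpret N: right_module R N by fact
  have "k \<in> rmod_hom R M N"
  proof (rule rmod_homI[OF kN])
    show "k (x \<oplus>\<^bsub>M\<^esub> y) = k x \<oplus>\<^bsub>N\<^esub> k y" if "x \<in> carrier M" "y \<in> carrier M" for x y
    proof (rule inj_onD[OF vh(2)])
      show "v (k (x \<oplus>\<^bsub>M\<^esub> y)) = v (k x \<oplus>\<^bsub>N\<^esub> k y)"
        using that vk kN u' v'(2) rmod_homD(2)[OF \<Theta>h(1)] by simp
    qed (use that kN in auto)
    show "k (x \<cdot>\<^bsub>M\<^esub> r) = k x \<cdot>\<^bsub>N\<^esub> r" if "x \<in> carrier M" "r \<in> carrier R" for x r
    proof (rule inj_onD[OF vh(2)])
      show "v (k (x \<cdot>\<^bsub>M\<^esub> r)) = v (k x \<cdot>\<^bsub>N\<^esub> r)"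
        using that vk kN u' v'(3) rmod_homD(3)[OF \<Theta>h(1)] by simp
    qed (use that kN in auto)
  qed
  moreover have "bij_betw k (carrier M) (carrier N)"
    unfolding bij_betw_def
  proof
    show "inj_on k (carrier M)"
    proof (rule inj_onI)
      fix x y assume xy: "x \<in> carrier M" "y \<in> carrier M" "k x = k y"
      then have "\<Theta> (u x) = \<Theta> (u y)" using vk by metis
      then have "u x = u y" using xy u'(1) \<Theta>h(2) by (auto simp: bij_betw_def dest: inj_onD)
      then show "x = y" using xy uh(2) by (auto dest: inj_onD)
    qed
    show "k ` carrier M = carrier N"
    proof
      show "k ` carrier M \<subseteq> carrier N" using kN by auto
      show "carrier N \<subseteq> k ` carrier M"
      proof
        fix y assume y: "y \<in> carrier N"
        \<comment> \<open>By \<open>2\<close>, the preimage of \<open>v y\<close> under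
          \<open>\<Theta>\<close> comes from \<open>M\<close>.\<close>
        then obtain x where x: "x \<in> carrier M" "\<Phi> (v y) = u x" using 2 by blast
        then have "v (k x) = v y" using vk \<Theta>\<Phi>[of "v y"] v'(1)[OF y] by simp
        then have "k x = y" using x y kN vh(2) by (auto dest: inj_onD)
        then show "y \<in> k ` carrier M" using x by blast
      qed
    qed
  qed
  ultimately show ?thesis by (auto simp: rmod_isomorphic_def rmod_iso_def)
qed

end
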